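(* In the standing setting below, assume $A$ has full column rank. Let $Q_1,Q_2,\dots$ be i.i.d. Haar-distributed elements of $\mathrm{SO}(d+1)$, and for each $T\in\mathbb{N}$ let $P_A^{(T)}=\sum_j(\beta^{(T)}_{\mathrm{aug}})_j\varphi_j$, where $\beta^{(T)}_{\mathrm{aug}}$ minimises $L_{\mathrm{aug}}$ with augmentation parameters $(T^{-1},Q_t)_{t=1}^T$. Then for every $\epsilon>0$, $$\frac{\varepsilon_{\mathrm{sym}}(P_A^{(T)})\sqrt T}{(\ln T)^{1/2+\epsilon}}\longrightarrow0\quad\text{almost surely as }T\to\infty.$$
   Context: $S^{N,d}=(S^d)^N$ with $L^2$ taken w.r.t. the product of normalised uniform surface measures; $Q\in\mathrm{SO}(d+1)$ acts elementwise, $Q\cdot(\mathbf r_1,\dots,\mathbf r_N)=(Q\mathbf r_1,\dots,Q\mathbf r_N)$. $V^{N,d}_K$: restrictions to $S^{N,d}$ of complex polynomials of total degree $\le K$ in Cartesian coordinates; $B^{N,d}_K$: its rotation-invariant subspace. Fix an orthonormal basis $\varphi_1,\dots,\varphi_m$ of $V^{N,d}_K$ with $\varphi_1,\dots,\varphi_{m_{\mathrm I}}$ a basis of $B^{N,d}_K$ and the rest a basis of its orthogonal complement. Fixed data: points $R_1,\dots,R_n\in S^{N,d}$, a rotation-invariant target $f$, $Y_i=f(R_i)$; design matrix $A_{ij}=\varphi_j(R_i)$; $(A\circ Q)_{ij}=\varphi_j(Q\cdot R_i)$. For weights $w_t$ and rotations $Q_t$, $L_{\mathrm{aug}}(\beta)=\frac12\sum_{t=1}^Tw_t\|(A\circ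 Q_t)\beta-Y\|^2$. $\varepsilon_{\mathrm{sym}}(g)=\|g-\mathrm{sym}(g)\|_{L^2}$, $\mathrm{sym}$ the $L^2$-orthogonal projection onto rotation-invariant functions. *)

theory Defs
  imports "HOL-Probability.Probability"
begin

text \<open>Points of S^d are vectors of type real^'n with CARD('n) = d+1;
  points of S^{N,d} are maps 'm => real^'n (N = CARD('m)).\<close>

definition sphereN :: "('m::finite \<Rightarrow> real^'n::finite) set" where
  "sphereN = {r. \<forall>a. norm (r a) = 1}"

definition SOgrp :: "(real^'n::finite^'n) set" where
  "SOgrp = {Q. orthogonal_matrix Q \<and> det Q = 1}"

definition rot :: "real^'n::finite^'n \<Rightarrow> ('m \<Rightarrow> real^'n) \<Rightarrow> ('m \<Rightarrow> real^'n)" where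
  "rot Q r = (\<lambda>a. Q *v r a)"

text \<open>Normalised uniform surface measure on S^d: the (cone-measure) push-forward of the
  normalised Lebesgue measure on the unit ball under radial projection.\<close>
definition sphere_measure :: "(real^'n::finite) measure" where
  "sphere_measure = distr (uniform_measure lborel (ball 0 1)) borel (\<lambda>x. x /\<^sub>R norm x)"

definition sphereN_measure :: "('m::finite \<Rightarrow> real^'n::finite) measure" where
  "sphereN_measure = PiM UNIV (\<lambda>_. sphere_measure)"

text \<open>Haar (normalised, left-invariant) probability measure on SO(d+1), viewed as a Borel
  measure on matrices concentrated on SO(d+1).  It is unique.\<close>
definition is_haar_SO :: "(real^'n::finite^'n) measure \<Rightarrow> bool" where
  "is_haar_SO H \<longleftrightarrow> prob_space H \<and> sets H = sets borel \<and> emeasure H SOgrp = 1 \<and>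
     (\<forall>G\<in>SOgrp. distr H borel (\<lambda>X. G ** X) = H)"

definition monomial :: "('m::finite \<Rightarrow> 'n::finite \<Rightarrow> nat) \<Rightarrow> ('m \<Rightarrow> real^'n) \<Rightarrow> complex" where
  "monomial e r = (\<Prod>a\<in>UNIV. \<Prod>k\<in>UNIV. complex_of_real ((r a $ k) ^ e a k))"

definition mdeg :: "('m::finite \<Rightarrow> 'n::finite \<Rightarrow> nat) \<Rightarrow> nat" where
  "mdeg e = (\<Sum>a\<in>UNIV. \<Sum>k\<in>UNIV. e a k)"

text \<open>V^{N,d}_K: (restrictions to S^{N,d} of) complex polynomials of total degree <= K in the
  Cartesian coordinates.  Functions are identified by their values on S^{N,d}.\<close>
definition Vspace :: "nat \<Rightarrow> (('m::finite \<Rightarrow> real^'n::finite) \<Rightarrow> complex) set" where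
  "Vspace K = {g. \<exists>E c. finite E \<and> (\<forall>e\<in>E. mdeg e \<le> K) \<and>
      (\<forall>r\<in>sphereN. g r = (\<Sum>e\<in>E. c e * monomial e r))}"

definition rot_invariant :: "(('m::finite \<Rightarrow> real^'n::finite) \<Rightarrow> 'b) \<Rightarrow> bool" where
  "rot_invariant g \<longleftrightarrow> (\<forall>Q\<in>SOgrp. \<forall>r\<in>sphereN. g (rot Q r) = g r)"

definition Bspace :: "nat \<Rightarrow> (('m::finite \<Rightarrow> real^'n::finite) \<Rightarrow> complex) set" where
  "Bspace K = {g \<in> Vspace K. rot_invariant g}"

definition L2inner :: "(('m::finite \<Rightarrow> real^'n::finite) \<Rightarrow> complex) \<Rightarrow> (('m \<Rightarrow> real^'n) \<Rightarrow> complex) \<Rightarrow> complex" where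
  "L2inner g h = (\<integral>r. g r * cnj (h r) \<partial>sphereN_measure)"

definition L2norm :: "(('m::finite \<Rightarrow> real^'n::finite) \<Rightarrow> complex) \<Rightarrow> real" where
  "L2norm g = sqrt (\<integral>r. (cmod (g r))\<^sup>2 \<partial>sphereN_measure)"

definition InvL2 :: "(('m::finite \<Rightarrow> real^'n::finite) \<Rightarrow> complex) set" where
  "InvL2 = {h. h \<in> borel_measurable sphereN_measure \<and>
              integrable sphereN_measure (\<lambda>r. (cmod (h r))\<^sup>2) \<and> rot_invariant h}"

definition sym_proj :: "(('m::finite \<Rightarrow> real^'n::finite) \<Rightarrow> complex) \<Rightarrow> (('m \<Rightarrow> real^'n) \<Rightarrow> complex)" where
  "sym_proj g = (SOME h. h \<in> InvL2 \<and> (\<forall>k\<in>InvL2. L2inner (\<lambda>r. g r - h r) k = 0))"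

definition eps_sym :: "(('m::finite \<Rightarrow> real^'n::finite) \<Rightarrow> complex) \<Rightarrow> real" where
  "eps_sym g = L2norm (\<lambda>r. g r - sym_proj g r)"

definition full_column_rank :: "nat \<Rightarrow> nat \<Rightarrow> (nat \<Rightarrow> nat \<Rightarrow> complex) \<Rightarrow> bool" where
  "full_column_rank n m A \<longleftrightarrow>
     (\<forall>\<beta>::nat \<Rightarrow> complex. (\<forall>i<n. (\<Sum>j<m. A i j * \<beta> j) = 0) \<longrightarrow> (\<forall>j<m. \<beta> j = 0))"

definition L_aug ::
  "nat \<Rightarrow> nat \<Rightarrow> (nat \<Rightarrow> ('m::finite \<Rightarrow> real^'n::finite) \<Rightarrow> complex) \<Rightarrow> (nat \<Rightarrow> 'm \<Rightarrow> real^'n)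
   \<Rightarrow> (nat \<Rightarrow> complex) \<Rightarrow> nat \<Rightarrow> (nat \<Rightarrow> real) \<Rightarrow> (nat \<Rightarrow> real^'n^'n) \<Rightarrow> (nat \<Rightarrow> complex) \<Rightarrow> real"
  where
  "L_aug n m \<phi> R Y T w Q \<beta> =
     1/2 * (\<Sum>t\<in>{1..T}. w t * (\<Sum>i<n. (cmod ((\<Sum>j<m. \<phi> j (rot (Q t) (R i)) * \<beta> j) - Y i))\<^sup>2))"

end

theory Submission
  imports Defs "HOL-Real_Asymp.Real_Asymp"
begin

text \<open>
  Let \<open>\<delta>\<close> be the difference between the minimiser and the least-squares fit over invariant
  polynomials, whose residual \<open>e\<close> is orthogonal to the invariant columns of \<open>A\<close>. Minimality gives
  \<open>1/T \<Sum>\<^sub>t \<parallel>(A \<circ> Q\<^sub>t) \<delta>\<parallel>\<^sup>2 \<le> 2 Re (1/T \<Sum>\<^sub>t \<langle>(A \<circ> Q\<^sub>t) \<delta>, e\<rangle>)\<close>.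
  Because \<open>A\<close> has full column rank and rotations act invertibly on polynomials of degree \<open>\<le> K\<close>,
  the left side dominates \<open>\<parallel>\<delta>\<parallel>\<^sup>2\<close> uniformly in the rotations; the right side is at most a
  constant times \<open>\<parallel>\<delta>\<parallel>\<close> times the sample means of \<open>\<phi>\<^sub>j (Q\<^sub>t R\<^sub>i)\<close> over the non-invariant
  indices \<open>j\<close>. These are i.i.d., bounded and, by orthogonality to the invariant polynomials,
  centred, so Hoeffding's inequality and Borel-Cantelli give the rate.
\<close>

section \<open>Bounded centred sums\<close>

text \<open>Since \<open>\<phi> j\<close> composed with a rotation \<open>G\<close> stays in
  \<open>Vspace K\<close>, it is a combination of the basis whose coefficients are fixed linear
  combinations of the numbers \<open>\<phi> j (rot G (R i))\<close>. This separates the rotation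
  from the point: Haar integrals only meet finite sums, and no Fubini argument on rotations times
  configurations is required. The fixed weights are a left inverse of \<open>A\<close>, which also
  yields the uniform lower bound on the quadratic term.

  Centring needs two stages. \<open>is_haar_SO\<close> speaks of left translations, which make
  averages over \<open>transpose Q\<close> invariant, whereas the sample is evaluated at
  \<open>rot (Q t) (R i)\<close>.

  Two gaps separate the coefficients from \<open>eps_sym\<close>. Orthogonality is assumed against
  invariant polynomials, but \<open>sym_proj\<close> refers to all invariant square-integrable
  functions; and \<open>sym_proj\<close> is a choice, determined only almost everywhere, applied to
  functions that may fail to be measurable off the sphere.\<close>

lemma (in prob_space) bounded_centred_sums_rate:
  fixes X :: "nat \<Rightarrow> 'a \<Rightarrow> real"
  assumes indep: "indep_vars (\<lambda>_. borel) X {1..}"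
    and bnd: "\<And>t. t \<ge> 1 \<Longrightarrow> AE \<omega> in M. \<bar>X t \<omega>\<bar> \<le> C"
    and mean: "\<And>t. t \<ge> 1 \<Longrightarrow> expectation (X t) = 0"
    and \<epsilon>: "\<epsilon> > 0"
  shows "AE \<omega> in M. (\<lambda>T. \<bar>\<Sum>t\<in>{1..T}. X t \<omega>\<bar> / (sqrt (real T) * ln (real T) powr (1/2 + \<epsilon>))) \<longlonglongrightarrow> 0"
proof -
  \<comment> \<open>The maximum with 1 keeps the denominator in Hoeffding's exponent
    positive.\<close>
  define D where "D = max C 1"
  have D: "D > 0" "D \<ge> C" by (auto simp: D_def)
  \<comment> \<open>The exponent lies half way between 1/2 and the target. Doubled it is
    \<open>1 + \<epsilon> > 1\<close>, so the Hoeffding tail falls below \<open>1 / T ^ 2\<close>;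
    and \<open>s\<close> divided by the target scale is \<open>ln T powr (- \<epsilon> / 2)\<close>,
    which still tends to 0.\<close>
  define s where "s T = sqrt (real T) * ln (real T) powr (1/2 + \<epsilon>/2)" for T :: nat
  define A where "A T = {\<omega> \<in> space M. \<bar>\<Sum>t\<in>{1..T}. X t \<omega>\<bar> \<ge> s T}" for T
  have rv [measurable]: "random_variable borel (X t)" if "t \<in> {1..}" for t
    using indep that unfolding indep_vars_def by blast
  have A_sets [measurable]: "A T \<in> sets M" for T
    unfolding A_def by measurable
  have tail: "prob (A T) \<le> 2 * exp (- (ln (real T) powr (1 + \<epsilon>)) / (2 * D\<^sup>2))" if T: "T \<ge> 1" for T
  proof -
    interpret Hoeffding_ineq M "{1..T}" X "\<lambda>_. -D" "\<lambda>_. D" "\<Sum>t\<in>{1..T}. expectation (X t)"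
    proof unfold_locales
      show "indep_vars (\<lambda>_. borel) X {1..T}"
        by (rule indep_vars_subset[OF indep]) auto
      show "AE x in M. X i x \<in> {- D..D}" if "i \<in> {1..T}" for i
        using bnd[of i] D that by (auto elim!: eventually_mono)
    qed auto
    have m0: "(\<Sum>t\<in>{1..T}. expectation (X t)) = 0"
      by (intro sum.neutral) (auto simp: mean)
    have "prob (A T) \<le> 2 * exp (-2 * (s T)\<^sup>2 / (\<Sum>i\<in>{1..T}. (D - (-D))\<^sup>2))"
      using Hoeffding_ineq_abs_ge[of "s T"] T D unfolding A_def m0
      by (auto simp: s_def)
    also have "-2 * (s T)\<^sup>2 / (\<Sum>i\<in>{1..T}. (D - (-D))\<^sup>2) = - (ln (real T) powr (1 + \<epsilon>)) / (2 * D\<^sup>2)"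
    proof -
      have "(s T)\<^sup>2 = real T * ln (real T) powr (1 + \<epsilon>)"
        unfolding s_def power_mult_distrib
        by (simp add: power2_eq_square powr_add[symmetric] real_sqrt_mult_self)
      then show ?thesis using T D by (simp add: field_simps power2_eq_square)
    qed
    finally show ?thesis .
  qed
  have "summable (\<lambda>T. prob (A T))"
  proof (rule summable_comparison_test_ev)
    have "eventually (\<lambda>T. 2 * exp (- (ln (real T) powr (1 + \<epsilon>)) / (2 * D\<^sup>2)) \<le> 1 / real T ^ 2) at_top"
      using D \<epsilon> by real_asymp
    then show "\<forall>\<^sub>F T in sequentially. norm (prob (A T)) \<le> 1 / real T ^ 2"
      using eventually_ge_at_top[of 1] by eventually_elim (use tail in fastforce)
    show "summable (\<lambda>T. 1 / real T ^ 2)"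
      using inverse_power_summable[of 2] by (simp add: field_simps)
  qed
  then have "AE \<omega> in M. eventually (\<lambda>T. \<omega> \<in> space M - A T) sequentially"
    by (intro borel_cantelli_AE1) (auto simp: emeasure_eq_measure)
  then show ?thesis
  proof eventually_elim
    case (elim \<omega>)
    show ?case
    proof (rule Lim_null_comparison)
      show "\<forall>\<^sub>F T in sequentially. norm (\<bar>\<Sum>t\<in>{1..T}. X t \<omega>\<bar> / (sqrt (real T) * ln (real T) powr (1/2 + \<epsilon>)))
        \<le> ln (real T) powr (- \<epsilon> / 2)"
        using elim eventually_ge_at_top[of 3]
      proof eventually_elim
        case (elim T)
        have l: "ln (real T) > 0" using elim by simp
        have "\<bar>\<Sum>t\<in>{1..T}. X t \<omega>\<bar> \<le> s T" using elim unfolding A_def by auto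
        then have "\<bar>\<Sum>t\<in>{1..T}. X t \<omega>\<bar> / (sqrt (real T) * ln (real T) powr (1/2 + \<epsilon>))
          \<le> s T / (sqrt (real T) * ln (real T) powr (1/2 + \<epsilon>))"
          by (intro divide_right_mono) auto
        also have "\<dots> = ln (real T) powr ((1/2 + \<epsilon>/2) - (1/2 + \<epsilon>))"
          unfolding s_def powr_diff using elim by simp
        also have "(1/2 + \<epsilon>/2) - (1/2 + \<epsilon>) = -\<epsilon>/2" by (simp add: field_simps)
        finally show ?case by simp
      qed
      show "(\<lambda>T. ln (real T) powr (- \<epsilon> / 2)) \<longlonglongrightarrow> 0"
        using \<epsilon> by real_asymp
    qed
  qed
qed

section \<open>Finite-dimensional least squares\<close>

text \<open>A Gram-Schmidt step for each column. The induction generalises \<open>Y\<close> because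
  the hypothesis is applied twice, to the right-hand side and to the new column. Dependent columns
  are allowed.\<close>

lemma exists_orthogonal_residual:
  fixes a :: "nat \<Rightarrow> 'j \<Rightarrow> complex"
  assumes "finite J"
  shows "\<exists>b. \<forall>k\<in>J. (\<Sum>i<n. cnj (a i k) * (Y i - (\<Sum>j\<in>J. a i j * b j))) = 0"
  using assms
proof (induction J arbitrary: Y)
  case empty
  then show ?case by simp
next
  case (insert p J)
  obtain u where u: "\<And>k. k \<in> J \<Longrightarrow> (\<Sum>i<n. cnj (a i k) * (a i p - (\<Sum>j\<in>J. a i j * u j))) = 0"
    using insert.IH[of "\<lambda>i. a i p"] by blast
  obtain b where b: "\<And>k. k \<in> J \<Longrightarrow> (\<Sum>i<n. cnj (a i k) * (Y i - (\<Sum>j\<in>J. a i j * b j))) = 0"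
    using insert.IH[of Y] by blast
  define v where "v i = a i p - (\<Sum>j\<in>J. a i j * u j)" for i
  define e where "e i = Y i - (\<Sum>j\<in>J. a i j * b j)" for i
  define N where "N = (\<Sum>i<n. cnj (v i) * v i)"
  \<comment> \<open>Coefficient of the projection of \<open>e\<close> onto \<open>v\<close>. If
    \<open>N = 0\<close>, the new column depends on the old ones, \<open>v\<close> vanishes, and any
    value would serve.\<close>
  define c where "c = (if N = 0 then 0 else (\<Sum>i<n. cnj (v i) * e i) / N)"
  define b' where "b' = (\<lambda>j. b j - c * u j)(p := c)"
  have b'_sum: "(\<Sum>j\<in>J. a i j * b' j) = (\<Sum>j\<in>J. a i j * (b j - c * u j))" for i
    using insert.hyps by (intro sum.cong) (auto simp: b'_def)
  have res: "Y i - (\<Sum>j\<in>insert p J. a i j * b' j) = e i - c * v i" for i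
    using insert.hyps
    by (simp add: b'_sum, simp add: b'_def e_def v_def algebra_simps sum_subtractf sum_distrib_left)
  have orth: "(\<Sum>i<n. cnj (a i k) * (e i - c * v i)) = 0" if "k \<in> J" for k
    using b[OF that] u[OF that]
    by (simp add: right_diff_distrib sum_subtractf e_def[symmetric] v_def[symmetric]
        mult.left_commute[of _ c] sum_distrib_left[symmetric])
  have N_real: "N = of_real (\<Sum>i<n. (cmod (v i))\<^sup>2)"
    unfolding N_def of_real_sum complex_norm_square by (simp add: mult.commute)
  have v_orth: "(\<Sum>i<n. cnj (v i) * (e i - c * v i)) = 0"
  proof (cases "N = 0")
    case True
    then have "(\<Sum>i<n. (cmod (v i))\<^sup>2) = 0"
      unfolding N_real using of_real_eq_0_iff by blast
    then have "\<forall>i<n. v i = 0" by (subst (asm) sum_nonneg_eq_0_iff) auto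
    then show ?thesis by simp
  next
    case False
    have "(\<Sum>i<n. cnj (v i) * (e i - c * v i)) = (\<Sum>i<n. cnj (v i) * e i) - c * N"
      by (simp add: right_diff_distrib sum_subtractf N_def sum_distrib_left mult.left_commute)
    then show ?thesis using False by (simp add: c_def)
  qed
  \<comment> \<open>The new column is \<open>v\<close> plus old columns, and the new residual is
    orthogonal to both.\<close>
  have "cnj (a i p) = cnj (v i) + (\<Sum>j\<in>J. cnj (u j) * cnj (a i j))" for i
    by (simp add: v_def mult.commute)
  then have "(\<Sum>i<n. cnj (a i p) * (e i - c * v i))
      = (\<Sum>i<n. cnj (v i) * (e i - c * v i))
        + (\<Sum>j\<in>J. cnj (u j) * (\<Sum>i<n. cnj (a i j) * (e i - c * v i)))"
    by (simp add: distrib_right sum.distrib sum_distrib_right sum_distrib_left mult.assoc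
        sum.swap[of _ "{..<n}" J])
  then have "(\<Sum>i<n. cnj (a i p) * (e i - c * v i)) = 0"
    using v_orth orth by simp
  then show ?case
    using orth by (intro exI[of _ b']) (auto simp only: res insert_iff)
qed

text \<open>The dual functional of a column is its residual against the other columns, normalised.\<close>

lemma full_column_rank_left_inverse:
  assumes "full_column_rank n m A"
  obtains L where "\<And>\<beta> j. j < m \<Longrightarrow> \<beta> j = (\<Sum>i<n. L j i * (\<Sum>k<m. A i k * \<beta> k))"
proof -
  have "\<exists>l. \<forall>\<beta>. \<beta> j = (\<Sum>i<n. l i * (\<Sum>k<m. A i k * \<beta> k))" if j: "j < m" for j
  proof -
    define J where "J = {..<m} - {j}"
    obtain b where b: "\<And>k. k \<in> J \<Longrightarrow> (\<Sum>i<n. cnj (A i k) * (A i j - (\<Sum>k\<in>J. A i k * b k))) = 0"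
      using exists_orthogonal_residual[where J = J and n = n and a = A and Y = "\<lambda>i. A i j"] by (auto simp: J_def)
    define v where "v i = A i j - (\<Sum>k\<in>J. A i k * b k)" for i
    have split: "(\<Sum>k<m. h k) = h j + (\<Sum>k\<in>J. h k)" for h :: "nat \<Rightarrow> complex"
      using j by (simp add: J_def sum.remove)
    have v_orth: "(\<Sum>i<n. cnj (v i) * A i k) = 0" if "k \<in> J" for k
      using arg_cong[OF b[OF that], of cnj] by (simp add: v_def mult.commute)
    \<comment> \<open>Pairing \<open>v\<close> with column \<open>j\<close> equals the squared norm
      of \<open>v\<close>, because \<open>v\<close> is orthogonal to the columns subtracted from
      column \<open>j\<close>.\<close>
    define N where "N = (\<Sum>i<n. cnj (v i) * A i j)"
    have "(\<Sum>i<n. cnj (v i) * v i) = N - (\<Sum>k\<in>J. b k * (\<Sum>i<n. cnj (v i) * A i k))"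
      by (simp add: v_def[of i for i] right_diff_distrib sum_subtractf N_def sum_distrib_left
          sum.swap[of _ "{..<n}" J] mult.left_commute mult.commute[of "A _ _" "b _"])
    then have N: "N = (\<Sum>i<n. cnj (v i) * v i)" using v_orth by simp
    have "N \<noteq> 0"
    proof
      assume "N = 0"
      then have "of_real (\<Sum>i<n. (cmod (v i))\<^sup>2) = (0::complex)"
        unfolding N of_real_sum complex_norm_square by (simp add: mult.commute)
      then have "(\<Sum>i<n. (cmod (v i))\<^sup>2) = 0" using of_real_eq_0_iff by blast
      then have v0: "\<forall>i<n. v i = 0" by (subst (asm) sum_nonneg_eq_0_iff) auto
      \<comment> \<open>If \<open>v\<close> vanished, column \<open>j\<close> would be a combination
        of the others; \<open>d\<close> is the resulting kernel vector, with entry 1 at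
        \<open>j\<close>.\<close>
      define d where "d k = (if k = j then 1 else - b k)" for k
      have "(\<Sum>k\<in>J. A i k * d k) = (\<Sum>k\<in>J. - (A i k * b k))" for i
        by (intro sum.cong) (auto simp: d_def J_def)
      then have "\<forall>i<n. (\<Sum>k<m. A i k * d k) = 0"
        using v0 by (simp add: split d_def sum_negf v_def)
      then have "d j = 0" using assms j unfolding full_column_rank_def by blast
      then show False by (simp add: d_def)
    qed
    have "\<beta> j = (\<Sum>i<n. cnj (v i) / N * (\<Sum>k<m. A i k * \<beta> k))" for \<beta>
    proof -
      have "(\<Sum>i<n. cnj (v i) / N * (\<Sum>k<m. A i k * \<beta> k))
          = (\<Sum>k<m. \<beta> k / N * (\<Sum>i<n. cnj (v i) * A i k))"
        by (simp add: sum_distrib_left sum.swap[of _ "{..<n}"] mult_ac)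
      also have "\<dots> = \<beta> j" using \<open>N \<noteq> 0\<close> v_orth by (simp add: split N_def)
      finally show ?thesis by simp
    qed
    then show ?thesis by (intro exI[of _ "\<lambda>i. cnj (v i) / N"]) blast
  qed
  then obtain L where "\<And>j \<beta>. j < m \<Longrightarrow> \<beta> j = (\<Sum>i<n. L j i * (\<Sum>k<m. A i k * \<beta> k))" by metis
  with that show thesis by blast
qed

section \<open>Rotation invariance of the sphere measure\<close>

text \<open>Fubini for \<open>1\<^sub>A (x + f y) 1\<^sub>B x\<close> with \<open>B\<close> the unit ball, whose \<open>f\<close>-preimages
  are again unit balls, pins the translation-invariant push-forward down to \<open>lborel\<close> itself.\<close>

lemma lborel_distr_orthogonal:
  fixes f :: "'a::euclidean_space \<Rightarrow> 'a"
  assumes f: "orthogonal_transformation f"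
  shows "distr lborel borel f = lborel"
proof (rule measure_eqI)
  show "sets (distr lborel borel f) = sets lborel" by simp
  fix A assume "A \<in> sets (distr lborel borel f)"
  then have A [measurable]: "A \<in> sets borel" by simp
  define g where "g = inv f"
  have fg: "f (g x) = x" for x
    using orthogonal_transformation_bij[OF f] by (simp add: g_def bij_is_surj surj_f_inv_f)
  have lin: "linear f" using f by (rule orthogonal_transformation_linear)
  have f_meas [measurable]: "f \<in> borel_measurable borel"
    using lin by (intro borel_measurable_continuous_onI linear_continuous_on) (simp add: linear_linear)
  define B where "B = (ball 0 1 :: 'a set)"
  have B [measurable]: "B \<in> sets borel" by (simp add: B_def)
  have shift: "(\<integral>\<^sup>+y. h (c + y) \<partial>lborel) = (\<integral>\<^sup>+y. h y \<partial>lborel)"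
    if [measurable]: "h \<in> borel_measurable borel" for h :: "'a \<Rightarrow> ennreal" and c
    by (subst (2) lborel_distr_plus[of c, symmetric]) (simp add: nn_integral_distr)
  have ballvol: "emeasure lborel (ball c 1) = emeasure lborel B" for c :: 'a
    by (simp add: B_def emeasure_ball)
  have fin: "emeasure lborel B \<noteq> 0" "emeasure lborel B \<noteq> \<top>"
    using unit_ball_vol_pos[of "real DIM('a)", THEN less_imp_neq, symmetric] by (simp_all add: B_def emeasure_ball)
  have pre: "(\<integral>\<^sup>+y. indicator B (x - f y) \<partial>lborel) = emeasure lborel B" for x
  proof -
    have "norm (x - f y) = norm (g x - y)" for y
      by (metis orthogonal_transformation_norm[OF f] linear_diff[OF lin] fg)
    then have "indicator B (x - f y) = (indicator (ball (g x) 1) y :: ennreal)" for y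
      using norm_minus_commute[of "f y" x] by (simp add: B_def indicator_def dist_norm)
    then show ?thesis by (simp add: ballvol)
  qed
  have fAm: "f -` A \<in> sets borel" using measurable_sets_borel[OF f_meas A] by simp
  have "emeasure lborel (f -` A) * emeasure lborel B
      = (\<integral>\<^sup>+x. (\<integral>\<^sup>+y. indicator A (f y) \<partial>lborel) * indicator B x \<partial>lborel)"
  proof -
    have "(\<integral>\<^sup>+y. indicator A (f y) \<partial>lborel) = emeasure lborel (f -` A)"
      using nn_integral_indicator[of "f -` A" lborel] fAm by (simp add: indicator_def)
    then show ?thesis by (simp add: nn_integral_cmult)
  qed
  also have "\<dots> = (\<integral>\<^sup>+x. (\<integral>\<^sup>+y. indicator A (x + f y) \<partial>lborel) * indicator B x \<partial>lborel)"
  proof (rule nn_integral_cong)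
    fix x
    \<comment> \<open>As \<open>x + f y = f (g x + y)\<close>, shifting the image by
      \<open>x\<close> amounts to shifting the integration variable by \<open>g x\<close>.\<close>
    have "(\<integral>\<^sup>+y. indicator A (f (g x + y)) \<partial>lborel) = (\<integral>\<^sup>+y. indicator A (f y) \<partial>lborel :: ennreal)"
      by (rule shift) measurable
    then show "(\<integral>\<^sup>+y. indicator A (f y) \<partial>lborel) * indicator B x
        = (\<integral>\<^sup>+y. indicator A (x + f y) \<partial>lborel :: ennreal) * indicator B x"
      by (simp add: linear_add[OF lin] fg)
  qed
  also have "\<dots> = (\<integral>\<^sup>+x. (\<integral>\<^sup>+y. indicator A (x + f y) * indicator B x \<partial>lborel) \<partial>lborel)"
    by (simp add: nn_integral_multc)
  also have "\<dots> = (\<integral>\<^sup>+y. (\<integral>\<^sup>+x. indicator A (x + f y) * indicator B x \<partial>lborel) \<partial>lborel)"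
    by (rule lborel_pair.Fubini') measurable
  also have "\<dots> = (\<integral>\<^sup>+y. (\<integral>\<^sup>+x. indicator A x * indicator B (x - f y) \<partial>lborel) \<partial>lborel)"
  proof (rule nn_integral_cong)
    fix y
    show "(\<integral>\<^sup>+x. indicator A (x + f y) * indicator B x \<partial>lborel)
        = (\<integral>\<^sup>+x. indicator A x * indicator B (x - f y) \<partial>lborel :: ennreal)"
      using shift[of "\<lambda>x. indicator A x * indicator B (x - f y)" "f y"] by (simp add: add.commute)
  qed
  also have "\<dots> = (\<integral>\<^sup>+x. (\<integral>\<^sup>+y. indicator A x * indicator B (x - f y) \<partial>lborel) \<partial>lborel)"
    by (rule lborel_pair.Fubini'[symmetric]) measurable
  also have "\<dots> = emeasure lborel A * emeasure lborel B"
    by (simp add: nn_integral_cmult pre nn_integral_multc)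
  finally have "emeasure lborel (f -` A) = emeasure lborel A"
    using fin by (simp add: ennreal_mult_cancel_left mult.commute[of _ "emeasure lborel B"])
  then show "emeasure (distr lborel borel f) A = emeasure lborel A"
    by (simp add: emeasure_distr)
qed

section \<open>The surface measure of one sphere: mass, support, rotation invariance\<close>

lemma sets_sphere_measure [simp, measurable_cong]: "sets sphere_measure = sets borel"
  by (simp add: sphere_measure_def)

lemma space_sphere_measure [simp]: "space sphere_measure = UNIV"
  by (simp add: sphere_measure_def)

lemma emeasure_unit_ball_nontrivial:
  "emeasure lborel (ball 0 1 :: 'a::euclidean_space set) \<noteq> 0"
  "emeasure lborel (ball 0 1 :: 'a::euclidean_space set) \<noteq> \<infinity>"
  using unit_ball_vol_pos[of "real DIM('a)", THEN less_imp_neq, symmetric] by (simp_all add: emeasure_ball)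

lemma prob_space_sphere_measure: "prob_space (sphere_measure :: (real^'n::finite) measure)"
  unfolding sphere_measure_def
  by (intro prob_space.prob_space_distr prob_space_uniform_measure emeasure_unit_ball_nontrivial)
    measurable

lemma AE_sphere_measure_norm: "AE x in (sphere_measure :: (real^'n::finite) measure). norm x = 1"
proof -
  have "AE x in uniform_measure lborel (ball 0 1 :: (real^'n) set). norm (x /\<^sub>R norm x) = 1"
    by (rule AE_uniform_measureI, simp) (use AE_lborel_singleton[of 0] in eventually_elim, simp)
  then show ?thesis
    unfolding sphere_measure_def by (subst AE_distr_iff) measurable
qed

text \<open>The radial projection is continuous off the origin, so the part of the punctured ball
  projecting into \<open>U\<close> is open; it contains \<open>x /\<^sub>R 2\<close>, hence has
  positive Lebesgue measure.\<close>

lemma sphere_measure_open_pos: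
  fixes U :: "(real^'n::finite) set"
  assumes "open U" "x \<in> U" "norm x = 1"
  shows "emeasure sphere_measure U > 0"
proof -
  define V where "V = (ball 0 1 - {0}) \<inter> (\<lambda>x. x /\<^sub>R norm x) -` U"
  have "continuous_on (ball 0 1 - {0}) (\<lambda>x :: real^'n. x /\<^sub>R norm x)"
    by (intro continuous_intros) auto
  then have V: "open V"
    unfolding V_def using \<open>open U\<close> by (intro continuous_open_preimage) auto
  have "x /\<^sub>R 2 \<in> V"
    using assms by (auto simp: V_def)
  then have "emeasure lborel V > 0"
    using open_not_negligible[OF V] V
    by (auto simp: negligible_iff_null_sets null_sets_completion_iff zero_less_iff_neq_zero null_sets_def)
  moreover have U': "(\<lambda>x. x /\<^sub>R norm x) -` U \<in> sets borel"
    using measurable_sets_borel[of "\<lambda>x. x /\<^sub>R norm x" borel U] \<open>open U\<close> by simp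
  then have "emeasure lborel V \<le> emeasure lborel (ball 0 1 \<inter> (\<lambda>x. x /\<^sub>R norm x) -` U)"
    by (intro emeasure_mono) (auto simp: V_def)
  ultimately have "emeasure lborel (ball 0 1 \<inter> (\<lambda>x. x /\<^sub>R norm x) -` U) > 0"
    by (rule less_le_trans)
  then show ?thesis
    using U' \<open>open U\<close> emeasure_unit_ball_nontrivial[where 'a = "real^'n"] unfolding sphere_measure_def
    by (subst emeasure_distr) (auto simp: ennreal_zero_less_divide less_top)
qed

text \<open>An orthogonal map preserves Lebesgue measure and the unit ball, and it commutes with the
  radial projection.\<close>

lemma sphere_measure_rotate:
  fixes G :: "real^'n::finite^'n"
  assumes "orthogonal_matrix G"
  shows "distr sphere_measure borel ((*v) G) = sphere_measure"
proof -
  have orth: "orthogonal_transformation ((*v) G)"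
    using assms by (simp add: orthogonal_transformation_matrix)
  have nrm: "norm (G *v x) = norm x" for x
    using orthogonal_transformation_norm[OF orth] .
  have [measurable]: "(*v) G \<in> borel_measurable borel"
    by (intro borel_measurable_continuous_onI matrix_vector_mult_linear_continuous_on)
  define U where "U = uniform_measure lborel (ball 0 1 :: (real^'n) set)"
  have [measurable_cong]: "sets U = sets borel" by (simp add: U_def)
  have U: "distr U borel ((*v) G) = U"
  proof (rule measure_eqI)
    fix A assume "A \<in> sets (distr U borel ((*v) G))"
    then have [measurable]: "A \<in> sets borel" by simp
    have pre: "((*v) G) -` A \<in> sets borel"
      using measurable_sets_borel[of "(*v) G" borel A] by simp
    have "emeasure lborel (ball 0 1 \<inter> ((*v) G) -` A) = emeasure (distr lborel borel ((*v) G)) (ball 0 1 \<inter> A)"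
      by (subst emeasure_distr) (auto simp: nrm intro!: arg_cong[where f = "emeasure lborel"])
    then have "emeasure lborel (ball 0 1 \<inter> ((*v) G) -` A) = emeasure lborel (ball 0 1 \<inter> A)"
      by (simp add: lborel_distr_orthogonal[OF orth])
    then show "emeasure (distr U borel ((*v) G)) A = emeasure U A"
      using pre by (simp add: emeasure_distr U_def)
  qed (simp add: U_def)
  have "distr sphere_measure borel ((*v) G) = distr U borel (\<lambda>x. G *v (x /\<^sub>R norm x))"
    unfolding sphere_measure_def U_def[symmetric] by (subst distr_distr) (auto simp: comp_def)
  also have "(\<lambda>x. G *v (x /\<^sub>R norm x)) = (\<lambda>x. x /\<^sub>R norm x) \<circ> ((*v) G)"
    by (simp add: fun_eq_iff nrm matrix_vector_mult_scaleR)
  also have "distr U borel \<dots> = distr (distr U borel ((*v) G)) borel (\<lambda>x. x /\<^sub>R norm x)"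
    by (subst distr_distr) auto
  also have "\<dots> = sphere_measure"
    unfolding U unfolding sphere_measure_def U_def ..
  finally show ?thesis .
qed

section \<open>The product measure on configurations\<close>

lemma sets_sphereN_measure [simp, measurable_cong]:
  "sets (sphereN_measure :: ('m::finite \<Rightarrow> real^'n::finite) measure) = sets (PiM UNIV (\<lambda>_. borel))"
  unfolding sphereN_measure_def by (intro sets_PiM_cong) auto

lemma space_sphereN_measure [simp]: "space sphereN_measure = UNIV"
  by (simp add: sphereN_measure_def space_PiM)

lemma prob_space_sphereN_measure:
  "prob_space (sphereN_measure :: ('m::finite \<Rightarrow> real^'n::finite) measure)"
  unfolding sphereN_measure_def by (intro prob_space_PiM prob_space_sphere_measure)

lemma AE_sphereN: "AE r in (sphereN_measure :: ('m::finite \<Rightarrow> real^'n::finite) measure). r \<in> sphereN"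
proof -
  have "AE r in (sphereN_measure :: ('m \<Rightarrow> real^'n) measure). norm (r a) = 1" for a
    unfolding sphereN_measure_def
    by (intro AE_PiM_component prob_space_sphere_measure AE_sphere_measure_norm) auto
  then have "AE r in (sphereN_measure :: ('m \<Rightarrow> real^'n) measure). \<forall>a\<in>UNIV. norm (r a) = 1"
    by (intro AE_finite_allI) auto
  then show ?thesis by (simp add: sphereN_def)
qed

lemma sphereN_sets [measurable]:
  "(sphereN :: ('m::finite \<Rightarrow> real^'n::finite) set) \<in> sets (PiM UNIV (\<lambda>_. borel))"
proof -
  have "(sphereN :: ('m \<Rightarrow> real^'n) set) = {r \<in> space (PiM UNIV (\<lambda>_. borel)). \<forall>a\<in>UNIV. norm (r a) = 1}"
    by (auto simp: sphereN_def space_PiM)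
  also have "\<dots> \<in> sets (PiM UNIV (\<lambda>_. borel))"
    by measurable
  finally show ?thesis .
qed

lemma sphereN_measure_rotate:
  fixes G :: "real^'n::finite^'n"
  assumes "orthogonal_matrix G"
  shows "distr (sphereN_measure :: ('m::finite \<Rightarrow> _) measure) (PiM UNIV (\<lambda>_. borel)) (rot G) = sphereN_measure"
proof -
  have [measurable]: "(*v) G \<in> borel_measurable borel"
    by (intro borel_measurable_continuous_onI matrix_vector_mult_linear_continuous_on)
  have "distr (PiM UNIV (\<lambda>_::'m. sphere_measure)) (PiM UNIV (\<lambda>_. sphere_measure)) (compose UNIV ((*v) G))
      = PiM UNIV (\<lambda>_. distr sphere_measure sphere_measure ((*v) G))"
    by (intro distr_PiM_finite_prob_space' prob_space_sphere_measure) auto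
  moreover have "compose UNIV ((*v) G) = (rot G :: ('m \<Rightarrow> _) \<Rightarrow> _)"
    by (auto simp: compose_def rot_def fun_eq_iff)
  moreover have "distr sphere_measure sphere_measure ((*v) G) = sphere_measure"
    using sphere_measure_rotate[OF assms] by (simp cong: distr_cong)
  ultimately show ?thesis
    using distr_cong[OF refl sets_sphereN_measure refl, of "sphereN_measure :: ('m \<Rightarrow> real^'n) measure" "rot G"]
    unfolding sphereN_measure_def by simp
qed

text \<open>Boxes of open sets meeting the sphere have positive measure.\<close>

lemma continuous_AE_zero_on_sphereN:
  fixes p :: "('m::finite \<Rightarrow> real^'n::finite) \<Rightarrow> complex"
  assumes cont: "continuous_on UNIV p"
    and ae: "AE r in sphereN_measure. p r = 0"
    and r: "r \<in> sphereN"
  shows "p r = 0"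
proof (rule ccontr)
  assume "p r \<noteq> 0"
  have "open (p -` (- {0}))"
    using continuous_on_open_vimage[OF open_UNIV, of p] cont by auto
  then obtain X where X: "r \<in> (\<Pi>\<^sub>E i\<in>UNIV. X i)" "\<And>i. open (X i)" "(\<Pi>\<^sub>E i\<in>UNIV. X i) \<subseteq> p -` (- {0})"
    using product_topology_open_contains_basis[of "\<lambda>_. euclidean" UNIV "p -` (- {0})" r] \<open>p r \<noteq> 0\<close>
    unfolding open_fun_def by (auto simp flip: open_openin)
  interpret S: product_prob_space "\<lambda>_::'m. sphere_measure :: (real^'n) measure"
    by (intro product_prob_spaceI prob_space_sphere_measure)
  have X_sets: "(\<Pi>\<^sub>E i\<in>UNIV. X i) \<in> sets sphereN_measure"
    using X(2) unfolding sphereN_measure_def by (intro sets_PiM_I_finite) auto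
  have "emeasure sphereN_measure (\<Pi>\<^sub>E i\<in>UNIV. X i) = (\<Prod>i\<in>UNIV. emeasure sphere_measure (X i))"
    using X(2) unfolding sphereN_measure_def by (intro S.emeasure_PiM) auto
  also have "\<dots> \<noteq> 0"
    using sphere_measure_open_pos[OF X(2)] X(1) r
    by (simp add: prod_zero_iff sphereN_def PiE_iff) (metis less_irrefl)
  finally have "emeasure sphereN_measure (\<Pi>\<^sub>E i\<in>UNIV. X i) \<noteq> 0" .
  moreover have "AE x in sphereN_measure. x \<notin> (\<Pi>\<^sub>E i\<in>UNIV. X i)"
    using ae by eventually_elim (use X(3) in auto)
  ultimately show False
    using X_sets by (simp add: AE_iff_measurable[OF _ refl] AE_iff_null_sets null_sets_def)
qed

section \<open>Polynomials on the sphere\<close>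

lemma orthogonal_SOgrp: "Q \<in> SOgrp \<Longrightarrow> orthogonal_matrix Q"
  by (simp add: SOgrp_def)

lemma transpose_SOgrp: "Q \<in> SOgrp \<Longrightarrow> transpose Q \<in> SOgrp"
  by (simp add: SOgrp_def orthogonal_matrix_transpose)

lemma transpose_mult_SOgrp: "Q \<in> SOgrp \<Longrightarrow> transpose Q ** Q = mat 1"
  by (simp add: SOgrp_def orthogonal_matrix)

lemma rot_mult: "rot (Q ** G) r = rot Q (rot G r)"
  by (simp add: rot_def matrix_vector_mul_assoc)

lemma rot_mat_1 [simp]: "rot (mat 1) r = r"
  by (simp add: rot_def)

lemma rot_sphereN: "Q \<in> SOgrp \<Longrightarrow> r \<in> sphereN \<Longrightarrow> rot Q r \<in> sphereN"
  using orthogonal_transformation_norm[of "(*v) Q"]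
  by (simp add: sphereN_def rot_def SOgrp_def orthogonal_transformation_matrix)

lemma rot_transpose: "Q \<in> SOgrp \<Longrightarrow> rot (transpose Q) (rot Q r) = r"
  by (simp flip: rot_mult add: transpose_mult_SOgrp)

section \<open>Closure of the polynomial space under algebra and rotations\<close>

lemma Vspace_cong: "g \<in> Vspace K \<Longrightarrow> (\<And>r. r \<in> sphereN \<Longrightarrow> h r = g r) \<Longrightarrow> h \<in> Vspace K"
  unfolding Vspace_def by auto

lemma monomial_Vspace: "mdeg e \<le> K \<Longrightarrow> monomial e \<in> Vspace K"
  unfolding Vspace_def by (auto intro!: exI[of _ "{e}"] exI[of _ "\<lambda>_. 1"])

lemma scale_Vspace: "g \<in> Vspace K \<Longrightarrow> (\<lambda>r. c * g r) \<in> Vspace K"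
proof -
  assume "g \<in> Vspace K"
  then obtain E d where "finite E" "\<forall>e\<in>E. mdeg e \<le> K" "\<forall>r\<in>sphereN. g r = (\<Sum>e\<in>E. d e * monomial e r)"
    unfolding Vspace_def by blast
  then show ?thesis unfolding Vspace_def
    by (auto intro!: exI[of _ E] exI[of _ "\<lambda>e. c * d e"] simp: sum_distrib_left mult.assoc)
qed

lemma zero_Vspace: "(\<lambda>_. 0) \<in> Vspace K"
  unfolding Vspace_def by (auto intro!: exI[of _ "{}"])

lemma add_Vspace:
  assumes "g \<in> Vspace K" "h \<in> Vspace K"
  shows "(\<lambda>r. g r + h r) \<in> Vspace K"
proof -
  obtain E c where E: "finite E" "\<forall>e\<in>E. mdeg e \<le> K" "\<forall>r\<in>sphereN. g r = (\<Sum>e\<in>E. c e * monomial e r)"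
    using assms(1) unfolding Vspace_def by blast
  obtain F d where F: "finite F" "\<forall>e\<in>F. mdeg e \<le> K" "\<forall>r\<in>sphereN. h r = (\<Sum>e\<in>F. d e * monomial e r)"
    using assms(2) unfolding Vspace_def by blast
  \<comment> \<open>The exponent sets may overlap, so both coefficient families are extended by zero
    to the union.\<close>
  define c' where "c' e = (if e \<in> E then c e else 0) + (if e \<in> F then d e else 0)" for e
  have "g r + h r = (\<Sum>e\<in>E \<union> F. c' e * monomial e r)" if "r \<in> sphereN" for r
  proof -
    have "(\<Sum>e\<in>E \<union> F. (if e \<in> E then c e else 0) * monomial e r) = (\<Sum>e\<in>E. c e * monomial e r)"
      using E(1) F(1) by (intro sum.mono_neutral_cong_right) auto
    moreover have "(\<Sum>e\<in>E \<union> F. (if e \<in> F then d e else 0) * monomial e r) = (\<Sum>e\<in>F. d e * monomial e r)"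
      using E(1) F(1) by (intro sum.mono_neutral_cong_right) auto
    ultimately show ?thesis
      using E(3) F(3) that by (simp add: c'_def distrib_right sum.distrib)
  qed
  then show ?thesis
    unfolding Vspace_def using E F by (auto intro!: exI[of _ "E \<union> F"] exI[of _ c'])
qed

lemma sum_Vspace: "(\<And>i. i \<in> I \<Longrightarrow> g i \<in> Vspace K) \<Longrightarrow> (\<lambda>r. \<Sum>i\<in>I. g i r) \<in> Vspace K"
  by (induction I rule: infinite_finite_induct) (simp_all add: zero_Vspace add_Vspace)

lemma mult_Vspace:
  assumes "g \<in> Vspace K" "h \<in> Vspace L"
  shows "(\<lambda>r. g r * h r) \<in> Vspace (K + L)"
proof -
  obtain E c where E: "finite E" "\<forall>e\<in>E. mdeg e \<le> K" "\<forall>r\<in>sphereN. g r = (\<Sum>e\<in>E. c e * monomial e r)"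
    using assms(1) unfolding Vspace_def by blast
  obtain F d where F: "finite F" "\<forall>e\<in>F. mdeg e \<le> L" "\<forall>r\<in>sphereN. h r = (\<Sum>e\<in>F. d e * monomial e r)"
    using assms(2) unfolding Vspace_def by blast
  have mono: "monomial e r * monomial e' r = monomial (\<lambda>a k. e a k + e' a k) r" for e e' and r :: "'a \<Rightarrow> real^'b"
    by (simp add: monomial_def power_add prod.distrib)
  have deg: "mdeg (\<lambda>a k. e a k + e' a k) = mdeg e + mdeg e'" for e e' :: "'a \<Rightarrow> 'b \<Rightarrow> nat"
    by (simp add: mdeg_def sum.distrib)
  \<comment> \<open>Different pairs of exponents can have the same sum; closure under finite sums
    avoids collecting coefficients.\<close>
  have "(\<lambda>r. \<Sum>e\<in>E. \<Sum>e'\<in>F. c e * d e' * monomial (\<lambda>a k. e a k + e' a k) r) \<in> Vspace (K + L)"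
    using E F by (intro sum_Vspace scale_Vspace monomial_Vspace) (auto simp: deg intro!: add_mono)
  then show ?thesis
    by (rule Vspace_cong) (use E F in \<open>simp add: sum_product mono[symmetric] mult_ac\<close>)
qed

lemma one_Vspace: "(\<lambda>_. 1) \<in> Vspace 0"
  by (rule Vspace_cong[OF monomial_Vspace[of "\<lambda>_ _. 0"]]) (simp_all add: monomial_def mdeg_def)

lemma prod_Vspace:
  "finite I \<Longrightarrow> (\<And>i. i \<in> I \<Longrightarrow> g i \<in> Vspace (K i)) \<Longrightarrow> (\<lambda>r. \<Prod>i\<in>I. g i r) \<in> Vspace (\<Sum>i\<in>I. K i)"
  by (induction I rule: finite_induct) (simp_all add: one_Vspace mult_Vspace)

lemma power_Vspace: "g \<in> Vspace K \<Longrightarrow> (\<lambda>r. g r ^ l) \<in> Vspace (l * K)"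
  by (induction l) (simp_all add: one_Vspace mult_Vspace)

lemma mono_Vspace: "g \<in> Vspace K \<Longrightarrow> K \<le> L \<Longrightarrow> g \<in> Vspace L"
  unfolding Vspace_def by (fast intro: le_trans)

lemma coordinate_Vspace: "(\<lambda>r. complex_of_real (r a $ k)) \<in> Vspace 1"
proof -
  define e where "e = (\<lambda>a' k'. if a' = a \<and> k' = k then 1 else 0 :: nat)"
  have inner: "(\<Sum>k'\<in>UNIV. e a' k') = (if a' = a then 1 else 0)" for a'
    by (simp add: e_def)
  have "mdeg e \<le> 1"
    by (simp add: mdeg_def inner)
  moreover have "monomial e r = complex_of_real (r a $ k)" for r
  proof -
    have "(\<Prod>k'\<in>UNIV. complex_of_real ((r a' $ k') ^ e a' k'))
        = (if a' = a then complex_of_real (r a $ k) else 1)" for a'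
    proof (cases "a' = a")
      case True
      then have "(\<Prod>k'\<in>UNIV. complex_of_real ((r a' $ k') ^ e a' k'))
          = (\<Prod>k'\<in>UNIV. if k' = k then complex_of_real (r a $ k') else 1)"
        by (intro prod.cong) (auto simp: e_def)
      then show ?thesis using True by simp
    qed (simp add: e_def)
    then show ?thesis by (simp add: monomial_def)
  qed
  ultimately show ?thesis using monomial_Vspace[of e 1] by (auto intro: Vspace_cong)
qed

text \<open>The coordinates of a rotated point are linear forms in the old coordinates, so a rotated
  monomial is a product of degree-1 forms and its degree does not grow.\<close>

lemma rot_Vspace:
  assumes g: "g \<in> Vspace K" and Q: "Q \<in> SOgrp"
  shows "(\<lambda>r. g (rot Q r)) \<in> Vspace K"
proof -
  obtain E c where E: "finite E" "\<forall>e\<in>E. mdeg e \<le> K" "\<forall>r\<in>sphereN. g r = (\<Sum>e\<in>E. c e * monomial e r)"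
    using g unfolding Vspace_def by blast
  have "(\<lambda>r. \<Sum>l\<in>UNIV. of_real (Q $ k $ l) * complex_of_real (r a $ l)) \<in> Vspace 1" for a k
    by (intro sum_Vspace scale_Vspace coordinate_Vspace)
  then have coord: "(\<lambda>r. complex_of_real (rot Q r a $ k)) \<in> Vspace 1" for a k
    by (simp add: rot_def matrix_vector_mult_def)
  have "(\<lambda>r. monomial e (rot Q r)) \<in> Vspace (mdeg e)" for e
  proof -
    have "(\<lambda>r. complex_of_real (rot Q r a $ k) ^ e a k) \<in> Vspace (e a k)" for a k
      using power_Vspace[OF coord, of a k "e a k"] by simp
    then show ?thesis
      unfolding monomial_def mdeg_def of_real_power by (intro prod_Vspace) auto
  qed
  then have "(\<lambda>r. \<Sum>e\<in>E. c e * monomial e (rot Q r)) \<in> Vspace K"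
    using E by (intro sum_Vspace scale_Vspace) (auto intro: mono_Vspace)
  then show ?thesis
    by (rule Vspace_cong) (simp add: E(3) rot_sphereN[OF Q])
qed

section \<open>Continuity and boundedness on the sphere\<close>

lemma continuous_monomial: "continuous_on UNIV (monomial e)"
  unfolding monomial_def
  by (intro continuous_intros continuous_on_prod continuous_on_product_coordinates)

lemma Vspace_continuous_extension:
  assumes "g \<in> Vspace K"
  obtains p where "continuous_on UNIV p" "\<And>r. r \<in> sphereN \<Longrightarrow> g r = p r"
proof -
  obtain E c where E: "finite E" "\<forall>r\<in>sphereN. g r = (\<Sum>e\<in>E. c e * monomial e r)"
    using assms unfolding Vspace_def by blast
  show thesis
    by (rule that[of "\<lambda>r. \<Sum>e\<in>E. c e * monomial e r"])
      (use E in \<open>auto intro!: continuous_on_sum continuous_on_mult continuous_monomial\<close>)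
qed

lemma cmod_monomial_le:
  assumes "r \<in> sphereN"
  shows "cmod (monomial e r) \<le> 1"
  unfolding monomial_def prod_norm[symmetric]
proof (intro prod_le_1 conjI prod_nonneg norm_ge_zero)
  fix a k
  have "\<bar>r a $ k\<bar> \<le> 1"
    using component_le_norm_cart[of "r a" k] assms by (simp add: sphereN_def)
  then show "cmod (complex_of_real ((r a $ k) ^ e a k)) \<le> 1"
    by (simp add: norm_power power_le_one)
qed

lemma Vspace_bounded:
  assumes "g \<in> Vspace K"
  obtains C where "\<And>r. r \<in> sphereN \<Longrightarrow> cmod (g r) \<le> C"
proof -
  obtain E c where E: "finite E" "\<forall>r\<in>sphereN. g r = (\<Sum>e\<in>E. c e * monomial e r)"
    using assms unfolding Vspace_def by blast
  show thesis
  proof (rule that[of "\<Sum>e\<in>E. cmod (c e)"])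
    fix r :: "'a \<Rightarrow> real^'b" assume r: "r \<in> sphereN"
    have "cmod (g r) \<le> (\<Sum>e\<in>E. cmod (c e * monomial e r))"
      using E(2) r by (simp add: norm_sum)
    also have "\<dots> \<le> (\<Sum>e\<in>E. cmod (c e))"
      using cmod_monomial_le[OF r] by (intro sum_mono) (simp add: norm_mult mult_left_le)
    finally show "cmod (g r) \<le> (\<Sum>e\<in>E. cmod (c e))" .
  qed
qed

text \<open>Members of \<open>Vspace\<close> are arbitrary, possibly non-measurable, off the sphere; cutting to the
  sphere turns them into bounded Borel functions without changing anything that matters.\<close>

definition sphere_cut :: "(('m::finite \<Rightarrow> real^'n::finite) \<Rightarrow> complex) \<Rightarrow> ('m \<Rightarrow> real^'n) \<Rightarrow> complex" where
  "sphere_cut g r = (if r \<in> sphereN then g r else 0)"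

lemma sphere_cut_Vspace_measurable:
  fixes g :: "('m::finite \<Rightarrow> real^'n::finite) \<Rightarrow> complex"
  assumes "g \<in> Vspace K"
  shows "sphere_cut g \<in> borel_measurable (PiM UNIV (\<lambda>_. borel))"
proof -
  obtain p where p: "continuous_on UNIV p" "\<And>r. r \<in> sphereN \<Longrightarrow> g r = p r"
    using Vspace_continuous_extension[OF assms] by blast
  have [measurable]: "p \<in> borel_measurable (PiM UNIV (\<lambda>_. borel))"
    using borel_measurable_continuous_onI[OF p(1)] measurable_cong_sets[OF sets_PiM_equal_borel refl] by blast
  have "sphere_cut g = (\<lambda>r. indicator sphereN r *\<^sub>R p r)"
    using p(2) by (auto simp: sphere_cut_def fun_eq_iff)
  also have "\<dots> \<in> borel_measurable (PiM UNIV (\<lambda>_. borel))"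
    by measurable
  finally show ?thesis .
qed

section \<open>Measurability and square integrability\<close>

lemma measurable_rot [measurable]:
  fixes r :: "'m::finite \<Rightarrow> real^'n::finite"
  shows "(\<lambda>Q. rot Q r) \<in> measurable borel (PiM UNIV (\<lambda>_. borel))"
proof (rule measurable_PiM_single')
  show "(\<lambda>Q. rot Q r a) \<in> borel_measurable borel" for a
    unfolding rot_def matrix_vector_mult_def
    by (intro borel_measurable_continuous_onI continuous_on_vec_lambda continuous_intros)
qed simp

lemma measurable_transpose [measurable]:
  "(transpose :: real^'n::finite^'n \<Rightarrow> _) \<in> borel_measurable borel"
  unfolding transpose_def
  by (intro borel_measurable_continuous_onI continuous_on_vec_lambda continuous_intros)

lemma measurable_matrix_mult [measurable]:
  "(\<lambda>Q. G ** Q) \<in> borel_measurable (borel :: (real^'n::finite^'n) measure)"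
  unfolding matrix_matrix_mult_def
  by (intro borel_measurable_continuous_onI continuous_on_vec_lambda continuous_intros)

lemma measurable_rot_matrix [measurable]:
  "rot (G :: real^'n::finite^'n) \<in> measurable (PiM UNIV (\<lambda>_. borel)) (PiM (UNIV :: 'm::finite set) (\<lambda>_. borel))"
proof (rule measurable_PiM_single')
  have [measurable]: "(*v) G \<in> borel_measurable borel"
    by (intro borel_measurable_continuous_onI matrix_vector_mult_linear_continuous_on)
  show "(\<lambda>r. rot G r a) \<in> borel_measurable (PiM UNIV (\<lambda>_. borel))" for a :: 'm
    unfolding rot_def by measurable
qed simp

lemma borel_measurable_cnj [measurable (raw)]:
  "f \<in> borel_measurable M \<Longrightarrow> (\<lambda>x. cnj (f x)) \<in> borel_measurable M"
  by (rule measurable_compose[OF _ borel_measurable_continuous_onI]) (auto intro: continuous_intros)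

lemma integrable_mult_cnj_L2:
  assumes [measurable]: "g \<in> borel_measurable M" "h \<in> borel_measurable M"
    and g: "integrable M (\<lambda>x. (cmod (g x))\<^sup>2)" and h: "integrable M (\<lambda>x. (cmod (h x))\<^sup>2)"
  shows "integrable M (\<lambda>x. g x * cnj (h x))"
proof (rule Bochner_Integration.integrable_bound[OF Bochner_Integration.integrable_add[OF g h]])
  have "cmod a * cmod b \<le> (cmod a)\<^sup>2 + (cmod b)\<^sup>2" for a b :: complex
    using sum_squares_bound[of "cmod a" "cmod b"] mult_nonneg_nonneg[OF norm_ge_zero norm_ge_zero, of a b]
    unfolding mult.assoc by linarith
  then show "AE x in M. norm (g x * cnj (h x)) \<le> norm ((cmod (g x))\<^sup>2 + (cmod (h x))\<^sup>2)"
    by (simp add: norm_mult)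
qed measurable

lemma AE_zero_L2:
  assumes [measurable]: "g \<in> borel_measurable M"
    and g: "integrable M (\<lambda>x. (cmod (g x))\<^sup>2)" and 0: "(\<integral>x. g x * cnj (g x) \<partial>M) = 0"
  shows "AE x in M. g x = 0"
proof -
  have "complex_of_real (\<integral>x. (cmod (g x))\<^sup>2 \<partial>M) = 0"
    using 0 unfolding complex_norm_square[symmetric] integral_complex_of_real .
  then have "(\<integral>x. (cmod (g x))\<^sup>2 \<partial>M) = 0" by simp
  then have "AE x in M. (cmod (g x))\<^sup>2 = 0"
    by (subst (asm) integral_nonneg_eq_0_iff_AE[OF g]) auto
  then show ?thesis by simp
qed

lemma sphere_cut_eq [simp]: "r \<in> sphereN \<Longrightarrow> sphere_cut g r = g r"
  by (simp add: sphere_cut_def)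

lemma sphere_cut_Vspace: "g \<in> Vspace K \<Longrightarrow> sphere_cut g \<in> Vspace K"
  by (erule Vspace_cong) simp

lemma sphere_cut_Vspace_bounded:
  assumes "g \<in> Vspace K"
  obtains C where "\<And>r. cmod (sphere_cut g r) \<le> C" "C \<ge> 0"
proof -
  obtain C where "\<And>r. r \<in> sphereN \<Longrightarrow> cmod (g r) \<le> C"
    using Vspace_bounded[OF assms] by blast
  then show thesis by (intro that[of "max C 0"]) (auto simp: sphere_cut_def le_max_iff_disj)
qed

lemma sphere_cut_Vspace_L2:
  fixes g :: "('m::finite \<Rightarrow> real^'n::finite) \<Rightarrow> complex"
  assumes g: "g \<in> Vspace K"
  shows "sphere_cut g \<in> borel_measurable sphereN_measure"
    and "integrable sphereN_measure (\<lambda>r. (cmod (sphere_cut g r))\<^sup>2)"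
proof -
  interpret prob_space "sphereN_measure :: ('m \<Rightarrow> real^'n) measure"
    by (rule prob_space_sphereN_measure)
  show m [measurable]: "sphere_cut g \<in> borel_measurable sphereN_measure"
    using sphere_cut_Vspace_measurable[OF g] by (simp cong: measurable_cong_sets)
  obtain C where C: "\<And>r. cmod (sphere_cut g r) \<le> C" "C \<ge> 0"
    using sphere_cut_Vspace_bounded[OF g] by blast
  show "integrable sphereN_measure (\<lambda>r. (cmod (sphere_cut g r))\<^sup>2)"
    by (rule integrable_const_bound[of _ "C\<^sup>2"]) (use C in \<open>auto intro!: power_mono\<close>)
qed

lemma sphere_cut_Bspace_InvL2:
  assumes "g \<in> Bspace K"
  shows "sphere_cut g \<in> InvL2"
  using assms sphere_cut_Vspace_L2 unfolding InvL2_def Bspace_def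
  by (auto simp: rot_invariant_def rot_sphereN)

text \<open>Equality on the sphere does not make \<open>g\<close> measurable, but a non-integrable
  integrand has Bochner integral 0. Both outcomes serve when an inner product is to vanish, which is
  how \<open>sym_proj\<close> candidates are checked.\<close>

lemma L2inner_eq_or_zero:
  assumes g' [measurable]: "g' \<in> borel_measurable sphereN_measure" and k [measurable]: "k \<in> borel_measurable sphereN_measure"
    and eq: "\<And>r. r \<in> sphereN \<Longrightarrow> g r = g' r"
  shows "L2inner g k = L2inner g' k \<or> L2inner g k = 0"
proof (cases "(\<lambda>r. g r * cnj (k r)) \<in> borel_measurable sphereN_measure")
  case True
  have "AE r in sphereN_measure. g r * cnj (k r) = g' r * cnj (k r)"
    using AE_sphereN by eventually_elim (simp add: eq)
  then have "L2inner g k = L2inner g' k"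
    unfolding L2inner_def using True
    by (intro integral_cong_AE) auto
  then show ?thesis ..
next
  case False
  then have "\<not> integrable sphereN_measure (\<lambda>r. g r * cnj (k r))"
    using borel_measurable_integrable by blast
  then show ?thesis by (simp add: L2inner_def not_integrable_integral_eq)
qed

section \<open>Haar averages of the basis\<close>

locale invariant_basis =
  fixes K m mI n :: nat
    and \<phi> :: "nat \<Rightarrow> ('m::finite \<Rightarrow> real^'n::finite) \<Rightarrow> complex"
    and R :: "nat \<Rightarrow> 'm \<Rightarrow> real^'n"
    and H :: "(real^'n^'n) measure"
  assumes phi_V: "j < m \<Longrightarrow> \<phi> j \<in> Vspace K"
    and phi_span: "g \<in> Vspace K \<Longrightarrow> \<exists>c. \<forall>r\<in>sphereN. g r = (\<Sum>j<m. c j * \<phi> j r)"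
    and mI_le: "mI \<le> m"
    and phi_B: "j < mI \<Longrightarrow> \<phi> j \<in> Bspace K"
    and phi_Bperp: "mI \<le> j \<Longrightarrow> j < m \<Longrightarrow> g \<in> Bspace K \<Longrightarrow> L2inner (\<phi> j) g = 0"
    and R_sphere: "i < n \<Longrightarrow> R i \<in> sphereN"
    and A_rank: "full_column_rank n m (\<lambda>i j. \<phi> j (R i))"
    and H_haar: "is_haar_SO H"
begin

text \<open>A left inverse of the design matrix: row \<open>j\<close> recovers the
  \<open>j\<close>-th coefficient of a polynomial from its values at the points
  \<open>R i\<close>.\<close>

definition dual :: "nat \<Rightarrow> nat \<Rightarrow> complex" where
  "dual = (SOME L. \<forall>\<beta>. \<forall>j<m. \<beta> j = (\<Sum>i<n. L j i * (\<Sum>k<m. \<phi> k (R i) * \<beta> k)))"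

lemma dual_coeff:
  assumes "j < m"
  shows "\<beta> j = (\<Sum>i<n. dual j i * (\<Sum>k<m. \<phi> k (R i) * \<beta> k))"
proof -
  obtain L where L: "\<And>\<beta> j. j < m \<Longrightarrow> \<beta> j = (\<Sum>i<n. L j i * (\<Sum>k<m. \<phi> k (R i) * \<beta> k))"
    by (rule full_column_rank_left_inverse[OF A_rank]) (rule that, assumption)
  have "\<forall>\<beta>. \<forall>j<m. \<beta> j = (\<Sum>i<n. dual j i * (\<Sum>k<m. \<phi> k (R i) * \<beta> k))"
    unfolding dual_def by (rule someI[of _ L]) (intro allI impI L)
  then show ?thesis using assms by (elim allE[of _ \<beta>] allE[of _ j] impE)
qed

lemma interpolation:
  assumes "g \<in> Vspace K" "r \<in> sphereN"
  shows "g r = (\<Sum>k<m. (\<Sum>i<n. dual k i * g (R i)) * \<phi> k r)"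
proof -
  obtain c where c: "\<And>r. r \<in> sphereN \<Longrightarrow> g r = (\<Sum>j<m. c j * \<phi> j r)"
    using phi_span[OF assms(1)] by blast
  have "c k = (\<Sum>i<n. dual k i * g (R i))" if "k < m" for k
    using dual_coeff[OF that, of c] by (simp add: c[OF R_sphere] mult.commute)
  then show ?thesis using c[OF assms(2)] by simp
qed

lemma phi_bounded:
  obtains C where "\<And>j r. j < m \<Longrightarrow> cmod (sphere_cut (\<phi> j) r) \<le> C" "C \<ge> 0"
proof -
  have "\<exists>C. (\<forall>r. cmod (sphere_cut (\<phi> j) r) \<le> C) \<and> C \<ge> 0" if "j < m" for j
    using sphere_cut_Vspace_bounded[OF phi_V[OF that]] by blast
  then have "\<forall>j\<in>{..<m}. \<exists>C. (\<forall>r. cmod (sphere_cut (\<phi> j) r) \<le> C) \<and> C \<ge> 0" by simp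
  then obtain C where "\<forall>j\<in>{..<m}. (\<forall>r. cmod (sphere_cut (\<phi> j) r) \<le> C j) \<and> C j \<ge> 0"
    by (rule bchoice[elim_format]) blast
  then have C: "\<And>j r. j < m \<Longrightarrow> cmod (sphere_cut (\<phi> j) r) \<le> C j" "\<And>j. j < m \<Longrightarrow> C j \<ge> 0"
    by auto
  show thesis
  proof (rule that[of "\<Sum>j<m. C j"])
    show "cmod (sphere_cut (\<phi> j) r) \<le> (\<Sum>j<m. C j)" if "j < m" for j r
      using C(1)[OF that, of r] member_le_sum[of j "{..<m}" C] C(2) that by force
    show "(\<Sum>j<m. C j) \<ge> 0" using C(2) by (auto intro: sum_nonneg)
  qed
qed

text \<open>Composition with \<open>Q\<close> is an automorphism of the polynomial space, so interpolating at
  the points \<open>R i\<close> and at the points \<open>rot Q (R i)\<close> is equally well conditioned.\<close>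

lemma coefficients_bounded_by_rotated_values:
  obtains C where "C \<ge> 0" "\<And>Q \<delta>. Q \<in> SOgrp \<Longrightarrow>
    (\<Sum>j<m. cmod (\<delta> j)) \<le> C * (\<Sum>i<n. cmod (\<Sum>j<m. \<phi> j (rot Q (R i)) * \<delta> j))"
proof -
  obtain B where B: "\<And>j r. j < m \<Longrightarrow> cmod (sphere_cut (\<phi> j) r) \<le> B" "B \<ge> 0"
    using phi_bounded by blast
  define D where "D = (\<Sum>k<m. \<Sum>i<n. cmod (dual k i))"
  have D: "D \<ge> 0" unfolding D_def by (intro sum_nonneg) auto
  have weighted: "(\<Sum>k<m. \<Sum>i<n. cmod (dual k i) * x i) \<le> D * X"
    if "\<And>i. i < n \<Longrightarrow> x i \<le> X" for x :: "nat \<Rightarrow> real" and X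
    unfolding D_def sum_distrib_right using that by (intro sum_mono mult_left_mono) auto
  show thesis
  \<comment> \<open>The factor \<open>D * B\<close> bounds \<open>g\<close> on the sphere by its
    values at the rotated points; the other \<open>D\<close> passes from the values
    \<open>g (R i)\<close> to the coefficients.\<close>
  proof (rule that[of "D * (D * B)"])
    show "D * (D * B) \<ge> 0" using D B by simp
    fix Q :: "real^'n^'n" and \<delta> :: "nat \<Rightarrow> complex"
    assume Q: "Q \<in> SOgrp"
    define g where "g r = (\<Sum>j<m. \<delta> j * \<phi> j r)" for r
    define N where "N = (\<Sum>i<n. cmod (g (rot Q (R i))))"
    have g: "g \<in> Vspace K"
      unfolding g_def by (intro sum_Vspace scale_Vspace phi_V) auto
    have N: "N \<ge> 0" "\<And>i. i < n \<Longrightarrow> cmod (g (rot Q (R i))) \<le> N"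
      unfolding N_def by (auto intro!: sum_nonneg member_le_sum)
    have gR: "cmod (g r) \<le> D * B * N" if r: "r \<in> sphereN" for r
    proof -
      have r': "rot (transpose Q) r \<in> sphereN" using r Q by (simp add: rot_sphereN transpose_SOgrp)
      \<comment> \<open>Interpolating \<open>g\<close> composed with \<open>rot Q\<close> at the
        points \<open>R i\<close> and evaluating at the back-rotated point gives \<open>g r\<close>
        from the values \<open>g (rot Q (R i))\<close>.\<close>
      have "rot Q (rot (transpose Q) r) = r"
        using rot_transpose[OF transpose_SOgrp[OF Q], of r] by simp
      then have "g r = (\<Sum>k<m. (\<Sum>i<n. dual k i * g (rot Q (R i))) * \<phi> k (rot (transpose Q) r))"
        using interpolation[OF rot_Vspace[OF g Q] r'] by simp
      also have "cmod \<dots> \<le> (\<Sum>k<m. \<Sum>i<n. cmod (dual k i) * (N * B))"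
      proof (intro order.trans[OF norm_sum] sum_mono)
        fix k assume "k \<in> {..<m}"
        then have "cmod (\<phi> k (rot (transpose Q) r)) \<le> B"
          using B(1)[of k "rot (transpose Q) r"] r' by simp
        then have "cmod ((\<Sum>i<n. dual k i * g (rot Q (R i))) * \<phi> k (rot (transpose Q) r))
            \<le> (\<Sum>i<n. cmod (dual k i) * N) * B"
          unfolding norm_mult
          by (intro mult_mono order.trans[OF norm_sum] sum_mono)
            (auto simp: norm_mult N intro!: mult_left_mono sum_nonneg)
        then show "cmod ((\<Sum>i<n. dual k i * g (rot Q (R i))) * \<phi> k (rot (transpose Q) r))
            \<le> (\<Sum>i<n. cmod (dual k i) * (N * B))"
          by (simp add: sum_distrib_right mult.assoc)
      qed
      also have "\<dots> \<le> D * (N * B)" by (rule weighted) simp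
      finally show ?thesis by (simp add: mult_ac)
    qed
    have "(\<Sum>j<m. cmod (\<delta> j)) \<le> (\<Sum>j<m. \<Sum>i<n. cmod (dual j i) * cmod (g (R i)))"
    proof (intro sum_mono)
      fix j assume "j \<in> {..<m}"
      then have "\<delta> j = (\<Sum>i<n. dual j i * g (R i))"
        using dual_coeff[of j \<delta>] by (simp add: g_def mult.commute)
      then show "cmod (\<delta> j) \<le> (\<Sum>i<n. cmod (dual j i) * cmod (g (R i)))"
        using norm_sum[of "\<lambda>i. dual j i * g (R i)" "{..<n}"] by (simp add: norm_mult)
    qed
    also have "\<dots> \<le> D * (D * B * N)" by (rule weighted) (simp add: gR R_sphere)
    finally show "(\<Sum>j<m. cmod (\<delta> j)) \<le> D * (D * B) * (\<Sum>i<n. cmod (\<Sum>j<m. \<phi> j (rot Q (R i)) * \<delta> j))"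
      by (simp add: N_def g_def mult_ac)
  qed
qed

section \<open>Haar measure and the averaging operator\<close>

lemma sets_H [simp, measurable_cong]: "sets H = sets borel"
  and prob_space_H: "prob_space H"
  and AE_H: "AE Q in H. Q \<in> SOgrp"
  and distr_H: "G \<in> SOgrp \<Longrightarrow> distr H borel (\<lambda>Q. G ** Q) = H"
proof -
  show H: "prob_space H" "sets H = sets borel"
    and "G \<in> SOgrp \<Longrightarrow> distr H borel (\<lambda>Q. G ** Q) = H"
    using H_haar unfolding is_haar_SO_def by auto
  interpret prob_space H by fact
  have e: "emeasure H SOgrp = 1" using H_haar unfolding is_haar_SO_def by auto
  \<comment> \<open>A non-measurable set would have \<open>emeasure\<close> 0, not 1.\<close>
  then have "SOgrp \<in> sets H" using emeasure_notin_sets[of SOgrp H] by fastforce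
  with e show "AE Q in H. Q \<in> SOgrp"
    by (intro AE_prob_1) (simp add: emeasure_eq_measure)
qed

lemma integral_H_translate:
  assumes "G \<in> SOgrp" and [measurable]: "F \<in> borel_measurable borel"
  shows "(\<integral>Q. F (G ** Q) \<partial>H) = (\<integral>Q. F Q \<partial>H :: complex)"
  by (subst (2) distr_H[OF assms(1), symmetric]) (simp add: integral_distr)

lemma borel_measurable_cut_rot [measurable]:
  "g \<in> Vspace L \<Longrightarrow> (\<lambda>Q. sphere_cut g (rot Q r)) \<in> borel_measurable borel"
  by (rule measurable_compose[OF measurable_rot sphere_cut_Vspace_measurable])

lemma integrable_cut_rot:
  assumes g: "g \<in> Vspace L"
  shows "integrable H (\<lambda>Q. sphere_cut g (rot Q r))" "integrable H (\<lambda>Q. sphere_cut g (rot (transpose Q) r))"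
proof -
  interpret prob_space H by (rule prob_space_H)
  note [measurable] = borel_measurable_cut_rot[OF g]
  obtain C where C: "\<And>r. cmod (sphere_cut g r) \<le> C" "C \<ge> 0"
    using sphere_cut_Vspace_bounded[OF g] by blast
  show "integrable H (\<lambda>Q. sphere_cut g (rot Q r))"
    by (rule integrable_const_bound[of _ C]) (use C in auto)
  have "(\<lambda>Q. sphere_cut g (rot (transpose Q) r)) \<in> borel_measurable borel"
    by (rule measurable_compose[OF measurable_transpose borel_measurable_cut_rot[OF g]])
  then show "integrable H (\<lambda>Q. sphere_cut g (rot (transpose Q) r))"
    by (intro integrable_const_bound[of _ C]) (use C in auto)
qed

text \<open>Averages over \<open>Q\<inverse>\<close> are invariant by left invariance of the Haar measure alone.\<close>

definition average :: "nat \<Rightarrow> ('m \<Rightarrow> real^'n) \<Rightarrow> complex" where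
  "average j r = (\<integral>Q. sphere_cut (\<phi> j) (rot (transpose Q) r) \<partial>H)"

text \<open>The matrix of the averaging operator in the basis \<open>\<phi>\<close>, read off by
  interpolating \<open>average j\<close>.\<close>

definition avg_coeff :: "nat \<Rightarrow> nat \<Rightarrow> complex" where
  "avg_coeff k j = (\<Sum>i<n. dual k i * average j (R i))"

text \<open>Interpolation of the rotated basis function. On the right, \<open>G\<close> enters only
  through finitely many scalars and \<open>r\<close> only through the basis, so each can be
  integrated separately.\<close>

lemma rotate_expansion:
  assumes "j < m" "G \<in> SOgrp" "r \<in> sphereN"
  shows "sphere_cut (\<phi> j) (rot G r) = (\<Sum>k<m. (\<Sum>i<n. dual k i * sphere_cut (\<phi> j) (rot G (R i))) * sphere_cut (\<phi> k) r)"
  using interpolation[OF rot_Vspace[OF phi_V[OF assms(1)] assms(2)] assms(3)] assms R_sphere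
  by (simp add: rot_sphereN)

text \<open>Here \<open>x\<close> collects whatever is independent of \<open>Q\<close>: basis values
  at a point, inner products with an invariant function, or Haar integrals.\<close>

lemma integral_rotation_coefficients:
  assumes "j < m"
  shows "(\<integral>Q. (\<Sum>k<m. (\<Sum>i<n. dual k i * sphere_cut (\<phi> j) (rot (transpose Q) (R i))) * x k) \<partial>H)
    = (\<Sum>k<m. avg_coeff k j * x k)"
proof -
  note int = integrable_cut_rot(2)[OF phi_V[OF assms]]
  have int_sum: "integrable H (\<lambda>Q. \<Sum>i<n. dual k i * sphere_cut (\<phi> j) (rot (transpose Q) (R i)))" for k
    by (intro Bochner_Integration.integrable_sum integrable_mult_right int)
  have "(\<integral>Q. (\<Sum>i<n. dual k i * sphere_cut (\<phi> j) (rot (transpose Q) (R i))) \<partial>H) = avg_coeff k j" for k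
    unfolding avg_coeff_def average_def
    by (subst Bochner_Integration.integral_sum) (intro integrable_mult_right int, simp)
  then show ?thesis
    by (subst Bochner_Integration.integral_sum) (intro integrable_mult_left int_sum, simp)
qed

lemma average_expansion:
  assumes "j < m" "r \<in> sphereN"
  shows "average j r = (\<Sum>k<m. avg_coeff k j * \<phi> k r)"
proof -
  have "average j r = (\<integral>Q. (\<Sum>k<m. (\<Sum>i<n. dual k i * sphere_cut (\<phi> j) (rot (transpose Q) (R i))) * sphere_cut (\<phi> k) r) \<partial>H)"
    unfolding average_def
  proof (rule integral_cong_AE)
    show "AE Q in H. sphere_cut (\<phi> j) (rot (transpose Q) r)
        = (\<Sum>k<m. (\<Sum>i<n. dual k i * sphere_cut (\<phi> j) (rot (transpose Q) (R i))) * sphere_cut (\<phi> k) r)"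
      using AE_H by eventually_elim (simp add: rotate_expansion[OF assms(1) transpose_SOgrp assms(2)])
  qed (intro borel_measurable_sum borel_measurable_times borel_measurable_const
      borel_measurable_integrable integrable_cut_rot(2)[OF phi_V[OF assms(1)]])+
  then show ?thesis
    using assms(2) by (simp add: integral_rotation_coefficients[OF assms(1)])
qed

lemma average_Bspace:
  assumes "j < m"
  shows "average j \<in> Bspace K"
proof -
  have "(\<lambda>r. \<Sum>k<m. avg_coeff k j * \<phi> k r) \<in> Vspace K"
    by (intro sum_Vspace scale_Vspace phi_V) auto
  then have "average j \<in> Vspace K"
    by (rule Vspace_cong) (simp add: average_expansion[OF assms])
  moreover have "average j (rot G r) = average j r" if G: "G \<in> SOgrp" for G r
  proof -
    \<comment> \<open>Left translation by \<open>transpose G\<close> replaces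
      \<open>transpose Q\<close> by \<open>transpose Q ** G\<close>, so \<open>G\<close> acts on
      \<open>r\<close> first.\<close>
    have "average j r = (\<integral>Q. sphere_cut (\<phi> j) (rot (transpose (transpose G ** Q)) r) \<partial>H)"
      unfolding average_def
      by (rule integral_H_translate[OF transpose_SOgrp[OF G], symmetric])
        (rule measurable_compose[OF measurable_transpose borel_measurable_cut_rot[OF phi_V[OF assms]]])
    then show ?thesis
      by (simp add: average_def matrix_transpose_mul rot_mult)
  qed
  ultimately show ?thesis by (simp add: Bspace_def rot_invariant_def)
qed

text \<open>Both \<open>k\<close> and the surface measure are rotation invariant, so
  \<open>\<phi> j\<close> may be replaced by any rotated copy inside the inner product. Expanding
  the copy in the basis and averaging the coefficients over the rotation gives the claim.\<close>

lemma L2inner_average: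
  assumes j: "j < m" and k: "k \<in> InvL2"
  shows "L2inner (sphere_cut (\<phi> j)) k = (\<Sum>l<m. avg_coeff l j * L2inner (sphere_cut (\<phi> l)) k)"
proof -
  interpret H: prob_space H by (rule prob_space_H)
  have k_meas [measurable]: "k \<in> borel_measurable sphereN_measure"
    and k_int: "integrable sphereN_measure (\<lambda>r. (cmod (k r))\<^sup>2)"
    and k_inv: "rot_invariant k"
    using k by (auto simp: InvL2_def)
  have phi_meas: "sphere_cut (\<phi> l) \<in> borel_measurable sphereN_measure" if "l < m" for l
    using sphere_cut_Vspace_L2(1)[OF phi_V[OF that]] .
  have int: "integrable sphereN_measure (\<lambda>r. sphere_cut (\<phi> l) r * cnj (k r))" if "l < m" for l
    using sphere_cut_Vspace_L2[OF phi_V[OF that]] k_meas k_int by (intro integrable_mult_cnj_L2)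
  have rot_m: "rot G \<in> measurable sphereN_measure (sphereN_measure :: ('m \<Rightarrow> real^'n) measure)" for G
    using measurable_rot_matrix by (simp cong: measurable_cong_sets)
  have *: "L2inner (sphere_cut (\<phi> j)) k
      = (\<Sum>l<m. (\<Sum>i<n. dual l i * sphere_cut (\<phi> j) (rot G (R i))) * L2inner (sphere_cut (\<phi> l)) k)"
    if G: "G \<in> SOgrp" for G
  proof -
    have "L2inner (sphere_cut (\<phi> j)) k
        = (\<integral>r. sphere_cut (\<phi> j) r * cnj (k r) \<partial>distr sphereN_measure sphereN_measure (rot G))"
      using sphereN_measure_rotate[OF orthogonal_SOgrp[OF G], where 'm = 'm]
      by (simp add: L2inner_def cong: distr_cong)
    also have "\<dots> = (\<integral>r. sphere_cut (\<phi> j) (rot G r) * cnj (k (rot G r)) \<partial>sphereN_measure)"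
      by (intro integral_distr rot_m borel_measurable_integrable int j)
    also have "\<dots> = (\<integral>r. (\<Sum>l<m. (\<Sum>i<n. dual l i * sphere_cut (\<phi> j) (rot G (R i))) * (sphere_cut (\<phi> l) r * cnj (k r))) \<partial>sphereN_measure)"
    proof (rule integral_cong_AE)
      show "AE r in sphereN_measure. sphere_cut (\<phi> j) (rot G r) * cnj (k (rot G r))
         = (\<Sum>l<m. (\<Sum>i<n. dual l i * sphere_cut (\<phi> j) (rot G (R i))) * (sphere_cut (\<phi> l) r * cnj (k r)))"
        using AE_sphereN
      proof eventually_elim
        case (elim r)
        then have "k (rot G r) = k r" using k_inv G by (simp add: rot_invariant_def)
        then show ?case
          unfolding rotate_expansion[OF j G elim] by (simp add: sum_distrib_right mult.assoc)
      qed
      show "(\<lambda>r. sphere_cut (\<phi> j) (rot G r) * cnj (k (rot G r))) \<in> borel_measurable sphereN_measure"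
        using measurable_compose[OF rot_m borel_measurable_integrable[OF int[OF j]]] .
    qed (intro borel_measurable_sum borel_measurable_times borel_measurable_const
        borel_measurable_cnj k_meas phi_meas, auto)
    also have "\<dots> = (\<Sum>l<m. (\<Sum>i<n. dual l i * sphere_cut (\<phi> j) (rot G (R i))) * L2inner (sphere_cut (\<phi> l)) k)"
      using int by (simp add: L2inner_def integral_sum)
    finally show ?thesis .
  qed
  have "L2inner (sphere_cut (\<phi> j)) k = (\<integral>Q. L2inner (sphere_cut (\<phi> j)) k \<partial>H)"
    by (simp add: H.prob_space)
  also have "\<dots> = (\<integral>Q. (\<Sum>l<m. (\<Sum>i<n. dual l i * sphere_cut (\<phi> j) (rot (transpose Q) (R i))) * L2inner (sphere_cut (\<phi> l)) k) \<partial>H)"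
  proof (rule integral_cong_AE)
    show "AE Q in H. L2inner (sphere_cut (\<phi> j)) k
        = (\<Sum>l<m. (\<Sum>i<n. dual l i * sphere_cut (\<phi> j) (rot (transpose Q) (R i))) * L2inner (sphere_cut (\<phi> l)) k)"
      using AE_H by eventually_elim (rule *[OF transpose_SOgrp])
  qed (intro borel_measurable_sum borel_measurable_times borel_measurable_const
      borel_measurable_integrable integrable_cut_rot(2)[OF phi_V[OF j]])+
  finally show ?thesis by (simp add: integral_rotation_coefficients[OF j])
qed

text \<open>The average \<open>a\<close> of \<open>\<phi> j\<close> is an invariant polynomial,
  hence orthogonal to \<open>\<phi> j\<close>; but averaging does not change inner products with
  invariant functions, so this inner product is also the squared norm of \<open>a\<close>.\<close>

lemma avg_coeff_zero:
  assumes j: "mI \<le> j" "j < m" and l: "l < m"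
  shows "avg_coeff l j = 0"
proof -
  define a where "a = sphere_cut (average j)"
  have B: "average j \<in> Bspace K" by (rule average_Bspace[OF j(2)])
  then have V: "average j \<in> Vspace K" by (simp add: Bspace_def)
  have a: "a \<in> InvL2" unfolding a_def by (rule sphere_cut_Bspace_InvL2[OF B])
  have "a \<in> Bspace K"
    using B unfolding a_def Bspace_def by (auto simp: rot_invariant_def rot_sphereN sphere_cut_Vspace)
  then have "L2inner (\<phi> j) a = 0" by (rule phi_Bperp[OF j])
  moreover have "(\<lambda>r. \<phi> j r * cnj (a r)) = (\<lambda>r. sphere_cut (\<phi> j) r * cnj (a r))"
    by (auto simp: fun_eq_iff sphere_cut_def a_def)
  ultimately have "0 = L2inner (sphere_cut (\<phi> j)) a"
    by (simp add: L2inner_def)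
  also have "\<dots> = (\<Sum>l<m. avg_coeff l j * L2inner (sphere_cut (\<phi> l)) a)"
    by (rule L2inner_average[OF j(2) a])
  also have "\<dots> = (\<integral>r. (\<Sum>l<m. avg_coeff l j * (sphere_cut (\<phi> l) r * cnj (a r))) \<partial>sphereN_measure)"
  proof -
    have "integrable sphereN_measure (\<lambda>r. sphere_cut (\<phi> l) r * cnj (a r))" if "l < m" for l
      using a sphere_cut_Vspace_L2[OF phi_V[OF that]] by (intro integrable_mult_cnj_L2) (auto simp: InvL2_def)
    then show ?thesis by (simp add: L2inner_def integral_sum)
  qed
  also have "(\<lambda>r. \<Sum>l<m. avg_coeff l j * (sphere_cut (\<phi> l) r * cnj (a r))) = (\<lambda>r. a r * cnj (a r))"
    by (auto simp: fun_eq_iff a_def sphere_cut_def average_expansion[OF j(2)] sum_distrib_right mult.assoc)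
  finally have "(\<integral>r. a r * cnj (a r) \<partial>sphereN_measure) = 0" ..
  then have ae: "AE r in sphereN_measure. a r = 0"
    using sphere_cut_Vspace_L2[OF V] unfolding a_def by (intro AE_zero_L2)
  \<comment> \<open>Vanishing almost everywhere says nothing by itself about the particular points
    \<open>R i\<close>; a continuous representative closes this gap.\<close>
  obtain p where p: "continuous_on UNIV p" "\<And>r. r \<in> sphereN \<Longrightarrow> average j r = p r"
    using Vspace_continuous_extension[OF V] by blast
  have "AE r in sphereN_measure. p r = 0"
    using ae AE_sphereN by eventually_elim (simp add: a_def p(2)[symmetric])
  then have "p r = 0" if "r \<in> sphereN" for r
    using continuous_AE_zero_on_sphereN[OF p(1)] that by blast
  then have "average j (R i) = 0" if "i < n" for i
    using p(2) R_sphere that by simp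
  then show ?thesis by (simp add: avg_coeff_def)
qed

text \<open>Extends orthogonality from invariant polynomials to every invariant square-integrable
  function, the class onto which \<open>sym_proj\<close> projects.\<close>

lemma phi_perp_InvL2:
  assumes "mI \<le> j" "j < m" "k \<in> InvL2"
  shows "L2inner (sphere_cut (\<phi> j)) k = 0"
  using L2inner_average[OF assms(2,3)] by (simp add: avg_coeff_zero[OF assms(1,2)])

text \<open>Left invariance inserts an extra \<open>G\<inverse>\<close> into the average over \<open>Q\<close>; averaging over \<open>G\<close>
  as well then kills it.\<close>

lemma integral_phi_rot_zero:
  assumes j: "mI \<le> j" "j < m" and r: "r \<in> sphereN"
  shows "(\<integral>Q. sphere_cut (\<phi> j) (rot Q r) \<partial>H) = 0"
proof -
  interpret H: prob_space H by (rule prob_space_H)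
  define b where "b l = (\<integral>Q. sphere_cut (\<phi> l) (rot Q r) \<partial>H)" for l
  have *: "b j = (\<Sum>l<m. (\<Sum>i<n. dual l i * sphere_cut (\<phi> j) (rot G (R i))) * b l)" if G: "G \<in> SOgrp" for G
  proof -
    note int = integrable_cut_rot(1)[OF phi_V]
    have "b j = (\<integral>Q. sphere_cut (\<phi> j) (rot (G ** Q) r) \<partial>H)"
      unfolding b_def
      by (rule integral_H_translate[OF G borel_measurable_cut_rot[OF phi_V[OF j(2)]], symmetric])
    also have "\<dots> = (\<integral>Q. (\<Sum>l<m. (\<Sum>i<n. dual l i * sphere_cut (\<phi> j) (rot G (R i))) * sphere_cut (\<phi> l) (rot Q r)) \<partial>H)"
    proof (rule integral_cong_AE)
      show "AE Q in H. sphere_cut (\<phi> j) (rot (G ** Q) r)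
          = (\<Sum>l<m. (\<Sum>i<n. dual l i * sphere_cut (\<phi> j) (rot G (R i))) * sphere_cut (\<phi> l) (rot Q r))"
        using AE_H by eventually_elim (simp only: rot_mult rotate_expansion[OF j(2) G rot_sphereN[OF _ r]])
      have "(\<lambda>Q. sphere_cut (\<phi> j) (rot (G ** Q) r)) \<in> borel_measurable borel"
        by (rule measurable_compose[OF measurable_matrix_mult borel_measurable_cut_rot[OF phi_V[OF j(2)]]])
      then show "(\<lambda>Q. sphere_cut (\<phi> j) (rot (G ** Q) r)) \<in> borel_measurable H"
        by (simp cong: measurable_cong_sets)
    qed (intro borel_measurable_sum borel_measurable_times borel_measurable_const
        borel_measurable_integrable int, auto)
    also have "\<dots> = (\<Sum>l<m. (\<Sum>i<n. dual l i * sphere_cut (\<phi> j) (rot G (R i))) * b l)"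
      using int by (simp add: b_def integral_sum)
    finally show ?thesis .
  qed
  have "b j = (\<integral>Q. b j \<partial>H)"
    by (simp add: H.prob_space)
  also have "\<dots> = (\<integral>Q. (\<Sum>l<m. (\<Sum>i<n. dual l i * sphere_cut (\<phi> j) (rot (transpose Q) (R i))) * b l) \<partial>H)"
  proof (rule integral_cong_AE)
    show "AE Q in H. b j = (\<Sum>l<m. (\<Sum>i<n. dual l i * sphere_cut (\<phi> j) (rot (transpose Q) (R i))) * b l)"
      using AE_H by eventually_elim (rule *[OF transpose_SOgrp])
  qed (intro borel_measurable_sum borel_measurable_times borel_measurable_const
      borel_measurable_integrable integrable_cut_rot(2)[OF phi_V[OF j(2)]])+
  finally show ?thesis
    by (simp add: integral_rotation_coefficients[OF j(2)] avg_coeff_zero[OF j] b_def)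
qed

section \<open>Symmetrisation error of the least-squares fit\<close>

text \<open>The invariant part \<open>q\<close> of the expansion is a valid projection because the
  remainder \<open>d\<close> is orthogonal to \<open>InvL2\<close>. So the error is the norm of
  \<open>d\<close>, at most its supremum since the measure has mass 1.\<close>

lemma eps_sym_le_coefficients:
  obtains C where "C \<ge> 0"
    "\<And>\<beta>. eps_sym (\<lambda>r. \<Sum>j<m. \<beta> j * \<phi> j r) \<le> C * (\<Sum>j\<in>{mI..<m}. cmod (\<beta> j))"
proof -
  obtain C where C: "\<And>j r. j < m \<Longrightarrow> cmod (sphere_cut (\<phi> j) r) \<le> C" "C \<ge> 0"
    using phi_bounded by blast
  show thesis
  proof (rule that[OF C(2)])
    fix \<beta> :: "nat \<Rightarrow> complex"
    interpret S: prob_space "sphereN_measure :: ('m \<Rightarrow> real^'n) measure"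
      by (rule prob_space_sphereN_measure)
    define g where "g r = (\<Sum>j<m. \<beta> j * \<phi> j r)" for r
    define q where "q r = (\<Sum>j<mI. \<beta> j * \<phi> j r)" for r
    define d where "d r = (\<Sum>j\<in>{mI..<m}. \<beta> j * sphere_cut (\<phi> j) r)" for r
    have split: "{..<m} = {..<mI} \<union> {mI..<m}" using mI_le by auto
    have gqd: "g r - sphere_cut q r = d r" if "r \<in> sphereN" for r
      using that unfolding g_def q_def d_def split by (subst sum.union_disjoint) auto
    have "(\<lambda>r. \<beta> j * \<phi> j r) \<in> Vspace K" if "j < mI" for j
      using phi_V[of j] mI_le that by (intro scale_Vspace) auto
    then have "q \<in> Vspace K"
      unfolding q_def by (intro sum_Vspace) auto
    moreover have "rot_invariant q"
      using phi_B by (simp add: q_def rot_invariant_def Bspace_def)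
    ultimately have qB: "q \<in> Bspace K" by (simp add: Bspace_def)
    have q: "sphere_cut q \<in> InvL2" by (rule sphere_cut_Bspace_InvL2[OF qB])
    have d_sum: "d = (\<lambda>r. \<Sum>j\<in>{mI..<m}. \<beta> j * sphere_cut (\<phi> j) r)" by (simp add: d_def fun_eq_iff)
    have phi_meas: "sphere_cut (\<phi> j) \<in> borel_measurable sphereN_measure" if "j < m" for j
      using sphere_cut_Vspace_L2(1)[OF phi_V[OF that]] .
    have d_meas [measurable]: "d \<in> borel_measurable sphereN_measure"
      unfolding d_sum by (intro borel_measurable_sum borel_measurable_times borel_measurable_const phi_meas) auto
    have phi_int: "integrable sphereN_measure (\<lambda>r. sphere_cut (\<phi> j) r * cnj (k r))"
      if "j < m" "k \<in> InvL2" for j k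
      using sphere_cut_Vspace_L2[OF phi_V[OF that(1)]] that(2)
      by (intro integrable_mult_cnj_L2) (auto simp: InvL2_def)
    have d_int: "integrable sphereN_measure (\<lambda>r. d r * cnj (k r))" if "k \<in> InvL2" for k
      unfolding d_sum sum_distrib_right mult.assoc
      by (intro Bochner_Integration.integrable_sum integrable_mult_right phi_int that) auto
    have d_perp: "L2inner d k = 0" if "k \<in> InvL2" for k
    proof -
      have "L2inner d k = (\<Sum>j\<in>{mI..<m}. \<beta> j * L2inner (sphere_cut (\<phi> j)) k)"
        unfolding L2inner_def d_sum sum_distrib_right mult.assoc
        by (subst Bochner_Integration.integral_sum) (auto intro!: integrable_mult_right phi_int that)
      then show ?thesis using phi_perp_InvL2[OF _ _ that] by simp
    qed
    define h where "h = sym_proj g"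
    have "sphere_cut q \<in> InvL2 \<and> (\<forall>k\<in>InvL2. L2inner (\<lambda>r. g r - sphere_cut q r) k = 0)"
    proof (intro conjI ballI q)
      fix k :: "('m \<Rightarrow> real^'n) \<Rightarrow> complex" assume k: "k \<in> InvL2"
      then have "k \<in> borel_measurable sphereN_measure" by (simp add: InvL2_def)
      from L2inner_eq_or_zero[OF d_meas this gqd] show "L2inner (\<lambda>r. g r - sphere_cut q r) k = 0"
        using d_perp[OF k] by auto
    qed
    then have "h \<in> InvL2 \<and> (\<forall>k\<in>InvL2. L2inner (\<lambda>r. g r - h r) k = 0)"
      unfolding h_def sym_proj_def
      by (rule someI[where P = "\<lambda>h. h \<in> InvL2 \<and> (\<forall>k\<in>InvL2. L2inner (\<lambda>r. g r - h r) k = 0)"])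
    then have h: "h \<in> InvL2" and h_perp: "\<And>k. k \<in> InvL2 \<Longrightarrow> L2inner (\<lambda>r. g r - h r) k = 0"
      by auto
    have h_meas [measurable]: "h \<in> borel_measurable sphereN_measure"
      and q_meas [measurable]: "sphere_cut q \<in> borel_measurable sphereN_measure"
      using h q by (auto simp: InvL2_def)
    \<comment> \<open>\<open>sym_proj\<close> may choose a projection other than \<open>q\<close>.
      The difference of the two is itself an admissible test function, and testing against it makes
      its squared norm 0.\<close>
    define \<kappa> where "\<kappa> = sphere_cut (\<lambda>r. h r - sphere_cut q r)"
    have "\<kappa> = (\<lambda>r. indicator sphereN r *\<^sub>R (h r - sphere_cut q r))"
      by (auto simp: \<kappa>_def sphere_cut_def fun_eq_iff)
    then have k_meas [measurable]: "\<kappa> \<in> borel_measurable sphereN_measure" by simp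
    have k_sq: "integrable sphereN_measure (\<lambda>r. (cmod (\<kappa> r))\<^sup>2)"
    proof (rule Bochner_Integration.integrable_bound)
      show "integrable sphereN_measure (\<lambda>r. 2 * (cmod (h r))\<^sup>2 + 2 * (cmod (sphere_cut q r))\<^sup>2)"
        using h q by (intro Bochner_Integration.integrable_add integrable_mult_right) (auto simp: InvL2_def)
      have "(cmod (a - b))\<^sup>2 \<le> 2 * (cmod a)\<^sup>2 + 2 * (cmod b)\<^sup>2" for a b :: complex
      proof -
        have "(cmod (a - b))\<^sup>2 \<le> (cmod a + cmod b)\<^sup>2"
          by (intro power_mono norm_triangle_ineq4) auto
        also have "\<dots> \<le> 2 * (cmod a)\<^sup>2 + 2 * (cmod b)\<^sup>2"
          using sum_squares_bound[of "cmod a" "cmod b"] by (simp add: power2_sum)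
        finally show ?thesis .
      qed
      then show "AE r in sphereN_measure. norm ((cmod (\<kappa> r))\<^sup>2)
          \<le> norm (2 * (cmod (h r))\<^sup>2 + 2 * (cmod (sphere_cut q r))\<^sup>2)"
        by (auto simp: \<kappa>_def sphere_cut_def)
    qed measurable
    have "rot_invariant \<kappa>"
      using h q by (auto simp: \<kappa>_def rot_invariant_def InvL2_def rot_sphereN)
    then have k: "\<kappa> \<in> InvL2" using k_sq by (simp add: InvL2_def)
    have "(\<lambda>r. (g r - h r) * cnj (\<kappa> r)) = (\<lambda>r. d r * cnj (\<kappa> r) - \<kappa> r * cnj (\<kappa> r))"
    proof
      fix r
      show "(g r - h r) * cnj (\<kappa> r) = d r * cnj (\<kappa> r) - \<kappa> r * cnj (\<kappa> r)"
        by (cases "r \<in> sphereN") (simp_all add: gqd[symmetric] \<kappa>_def sphere_cut_def algebra_simps)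
    qed
    then have "L2inner (\<lambda>r. g r - h r) \<kappa> = L2inner d \<kappa> - (\<integral>r. \<kappa> r * cnj (\<kappa> r) \<partial>sphereN_measure)"
      using d_int[OF k] integrable_mult_cnj_L2[OF k_meas k_meas k_sq k_sq]
      unfolding L2inner_def by simp
    then have "(\<integral>r. \<kappa> r * cnj (\<kappa> r) \<partial>sphereN_measure) = 0"
      using h_perp[OF k] d_perp[OF k] by simp
    then have "AE r in sphereN_measure. \<kappa> r = 0"
      by (intro AE_zero_L2 k_meas k_sq)
    then have ae: "AE r in sphereN_measure. (cmod (g r - h r))\<^sup>2 = (cmod (d r))\<^sup>2"
      using AE_sphereN by eventually_elim (simp add: gqd[symmetric] \<kappa>_def)
    define D where "D = C * (\<Sum>j\<in>{mI..<m}. cmod (\<beta> j))"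
    have D: "D \<ge> 0" using C(2) by (auto simp: D_def intro!: mult_nonneg_nonneg sum_nonneg)
    have d_le: "cmod (d r) \<le> D" for r
      unfolding d_def D_def sum_distrib_left
      by (intro order.trans[OF norm_sum] sum_mono) (auto simp: norm_mult mult.commute[of C] intro!: mult_left_mono C)
    \<comment> \<open>Off the sphere \<open>g\<close> is arbitrary, so the integrand may fail to be
      integrable; its integral is then 0 and the bound is trivial.\<close>
    have "(\<integral>r. (cmod (g r - h r))\<^sup>2 \<partial>sphereN_measure) \<le> D\<^sup>2"
    proof (cases "integrable sphereN_measure (\<lambda>r. (cmod (g r - h r))\<^sup>2)")
      case True
      have "AE r in sphereN_measure. (cmod (g r - h r))\<^sup>2 \<le> D\<^sup>2"
        using ae by eventually_elim (simp add: d_le power_mono)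
      with True show ?thesis by (intro S.integral_le_const)
    qed (simp add: not_integrable_integral_eq)
    then have "L2norm (\<lambda>r. g r - h r) \<le> D"
      unfolding L2norm_def using D by (intro real_le_lsqrt) auto
    then show "eps_sym (\<lambda>r. \<Sum>j<m. \<beta> j * \<phi> j r) \<le> C * (\<Sum>j\<in>{mI..<m}. cmod (\<beta> j))"
      unfolding eps_sym_def D_def h_def g_def .
  qed
qed

text \<open>A deterministic estimate: \<open>C\<close> depends on neither \<open>T\<close>, the
  rotations nor the minimiser, so all randomness is left in finitely many scalar sums.\<close>

lemma minimiser_noninvariant_part_le:
  fixes Y :: "nat \<Rightarrow> complex"
  obtains C where "C \<ge> 0"
    "\<And>T Q b. T \<ge> 1 \<Longrightarrow> (\<And>t. t \<in> {1..T} \<Longrightarrow> Q t \<in> SOgrp) \<Longrightarrow>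
      (\<And>b'. L_aug n m \<phi> R Y T (\<lambda>_. 1 / real T) Q b \<le> L_aug n m \<phi> R Y T (\<lambda>_. 1 / real T) Q b') \<Longrightarrow>
      (\<Sum>j\<in>{mI..<m}. cmod (b j))
        \<le> C * ((\<Sum>i<n. \<Sum>j\<in>{mI..<m}. cmod (\<Sum>t\<in>{1..T}. sphere_cut (\<phi> j) (rot (Q t) (R i)))) / real T)"
proof -
  obtain b0 where b0: "\<And>k. k < mI \<Longrightarrow>
      (\<Sum>i<n. cnj (\<phi> k (R i)) * (Y i - (\<Sum>j<mI. \<phi> j (R i) * b0 j))) = 0"
    using exists_orthogonal_residual[where J = "{..<mI}" and n = n and a = "\<lambda>i j. \<phi> j (R i)" and Y = Y]
    by auto
  define e where "e i = Y i - (\<Sum>j<mI. \<phi> j (R i) * b0 j)" for i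
  \<comment> \<open>A competitor for all rotations at once: it uses only invariant columns, which do
    not change under rotation, so its residual is \<open>e\<close> for every
    \<open>t\<close>.\<close>
  define b1 where "b1 j = (if j < mI then b0 j else 0)" for j
  define E where "E = (\<Sum>i<n. cmod (e i))"
  obtain C0 where C0: "C0 \<ge> 0" "\<And>Q \<delta>. Q \<in> SOgrp \<Longrightarrow>
    (\<Sum>j<m. cmod (\<delta> j)) \<le> C0 * (\<Sum>i<n. cmod (\<Sum>j<m. \<phi> j (rot Q (R i)) * \<delta> j))"
    using coefficients_bounded_by_rotated_values by blast
  have E: "E \<ge> 0" "\<And>i. i < n \<Longrightarrow> cmod (e i) \<le> E"
    unfolding E_def by (auto intro!: sum_nonneg member_le_sum)
  have orth: "(\<Sum>i<n. \<phi> k (R i) * cnj (e i)) = 0" if "k < mI" for k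
    using arg_cong[OF b0[OF that], of cnj] by (simp add: e_def)
  have split: "(\<Sum>j<m. F j) = (\<Sum>j<mI. F j) + (\<Sum>j\<in>{mI..<m}. F j)" for F :: "nat \<Rightarrow> complex"
    using mI_le by (subst sum.union_disjoint[symmetric]) (auto intro!: sum.cong)
  have inv: "\<phi> j (rot Q (R i)) = \<phi> j (R i)" if "j < mI" "Q \<in> SOgrp" "i < n" for j Q i
    using phi_B[OF that(1)] that R_sphere by (auto simp: Bspace_def rot_invariant_def)
  \<comment> \<open>\<open>C0\<close> is squared with the coefficient bound, \<open>real n\<close>
    comes from Cauchy-Schwarz over the points, and \<open>2 * E\<close> from the cross term.\<close>
  define C where "C = C0\<^sup>2 * real n * (2 * E)"
  show thesis
  proof (rule that[of C])
    show "C \<ge> 0" using E by (simp add: C_def)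
    fix T :: nat and Q :: "nat \<Rightarrow> real^'n^'n" and b
    assume T: "T \<ge> 1" and Q: "\<And>t. t \<in> {1..T} \<Longrightarrow> Q t \<in> SOgrp"
      and min: "\<And>b'. L_aug n m \<phi> R Y T (\<lambda>_. 1 / real T) Q b \<le> L_aug n m \<phi> R Y T (\<lambda>_. 1 / real T) Q b'"
    define \<delta> where "\<delta> j = b j - b1 j" for j
    define x where "x t i = (\<Sum>j<m. \<phi> j (rot (Q t) (R i)) * \<delta> j)" for t i
    define Z where "Z i j = (\<Sum>t\<in>{1..T}. sphere_cut (\<phi> j) (rot (Q t) (R i)))" for i j
    define S where "S = (\<Sum>i<n. \<Sum>j\<in>{mI..<m}. cmod (Z i j))"
    define N where "N = (\<Sum>j<m. cmod (\<delta> j))"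
    have S: "S \<ge> 0" unfolding S_def by (intro sum_nonneg) auto
    have N: "N \<ge> 0" "\<And>j. j < m \<Longrightarrow> cmod (\<delta> j) \<le> N"
      unfolding N_def by (auto intro!: sum_nonneg member_le_sum)
    have base: "(\<Sum>j<m. \<phi> j (rot (Q t) (R i)) * b1 j) - Y i = - e i" if "t \<in> {1..T}" "i < n" for t i
      using inv[OF _ Q[OF that(1)] that(2)] by (simp add: split b1_def e_def)
    have fit: "(\<Sum>j<m. \<phi> j (rot (Q t) (R i)) * b j) - Y i = x t i - e i" if "t \<in> {1..T}" "i < n" for t i
      using base[OF that] by (simp add: x_def \<delta>_def right_diff_distrib sum_subtractf algebra_simps)
    have "(\<Sum>t\<in>{1..T}. \<Sum>i<n. (cmod (x t i - e i))\<^sup>2) \<le> (\<Sum>t\<in>{1..T}. \<Sum>i<n. (cmod (e i))\<^sup>2)"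
    proof -
      have L: "L_aug n m \<phi> R Y T (\<lambda>_. 1 / real T) Q c = (\<Sum>t\<in>{1..T}. \<Sum>i<n. (cmod (v t i))\<^sup>2) / (2 * real T)"
        if "\<And>t i. t \<in> {1..T} \<Longrightarrow> i < n \<Longrightarrow> (\<Sum>j<m. \<phi> j (rot (Q t) (R i)) * c j) - Y i = v t i" for c v
        unfolding L_aug_def using that by (simp add: sum_divide_distrib mult.commute)
      have Lb: "L_aug n m \<phi> R Y T (\<lambda>_. 1 / real T) Q b
          = (\<Sum>t\<in>{1..T}. \<Sum>i<n. (cmod (x t i - e i))\<^sup>2) / (2 * real T)"
        by (rule L[of b "\<lambda>t i. x t i - e i"]) (rule fit)
      have Lb1: "L_aug n m \<phi> R Y T (\<lambda>_. 1 / real T) Q b1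
          = (\<Sum>t\<in>{1..T}. \<Sum>i<n. (cmod (- e i))\<^sup>2) / (2 * real T)"
        by (rule L[of b1 "\<lambda>t i. - e i"]) (rule base)
      show ?thesis
        using min[of b1] T unfolding Lb Lb1 divide_le_cancel norm_minus_cancel by simp
    qed
    moreover have "(cmod (x t i - e i))\<^sup>2 = (cmod (x t i))\<^sup>2 - 2 * Re (x t i * cnj (e i)) + (cmod (e i))\<^sup>2" for t i
      unfolding cmod_power2 by (simp add: power2_eq_square algebra_simps)
    ultimately have quad: "(\<Sum>t\<in>{1..T}. \<Sum>i<n. (cmod (x t i))\<^sup>2) \<le> 2 * Re (\<Sum>t\<in>{1..T}. \<Sum>i<n. x t i * cnj (e i))"
      by (simp add: sum.distrib sum_subtractf sum_distrib_left)
    have "(\<Sum>t\<in>{1..T}. \<Sum>i<n. x t i * cnj (e i))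
        = (\<Sum>t\<in>{1..T}. \<Sum>i<n. \<Sum>j\<in>{mI..<m}. sphere_cut (\<phi> j) (rot (Q t) (R i)) * \<delta> j * cnj (e i))"
    proof (rule sum.cong[OF refl])
      fix t assume t: "t \<in> {1..T}"
      have x: "x t i = (\<Sum>j<mI. \<phi> j (R i) * \<delta> j) + (\<Sum>j\<in>{mI..<m}. sphere_cut (\<phi> j) (rot (Q t) (R i)) * \<delta> j)"
        if "i < n" for i
        using inv[OF _ Q[OF t] that] R_sphere[OF that] Q[OF t] by (simp add: x_def split rot_sphereN)
      \<comment> \<open>The invariant columns drop out of the cross term because \<open>e\<close> is
        orthogonal to them; only the centred columns remain.\<close>
      have "(\<Sum>i<n. (\<Sum>j<mI. \<phi> j (R i) * \<delta> j) * cnj (e i)) = (\<Sum>j<mI. \<delta> j * (\<Sum>i<n. \<phi> j (R i) * cnj (e i)))"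
        by (simp add: sum_distrib_left sum_distrib_right sum.swap[of _ "{..<n}"] mult_ac)
      then have "(\<Sum>i<n. (\<Sum>j<mI. \<phi> j (R i) * \<delta> j) * cnj (e i)) = 0" using orth by simp
      then show "(\<Sum>i<n. x t i * cnj (e i))
          = (\<Sum>i<n. \<Sum>j\<in>{mI..<m}. sphere_cut (\<phi> j) (rot (Q t) (R i)) * \<delta> j * cnj (e i))"
        by (simp add: x distrib_right sum.distrib sum_distrib_right)
    qed
    also have "\<dots> = (\<Sum>i<n. \<Sum>t\<in>{1..T}. \<Sum>j\<in>{mI..<m}. sphere_cut (\<phi> j) (rot (Q t) (R i)) * \<delta> j * cnj (e i))"
      by (rule sum.swap)
    also have "\<dots> = (\<Sum>i<n. \<Sum>j\<in>{mI..<m}. \<Sum>t\<in>{1..T}. sphere_cut (\<phi> j) (rot (Q t) (R i)) * \<delta> j * cnj (e i))"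
      by (intro sum.cong refl sum.swap)
    also have "\<dots> = (\<Sum>i<n. \<Sum>j\<in>{mI..<m}. Z i j * \<delta> j * cnj (e i))"
      by (simp add: Z_def sum_distrib_right)
    finally have "Re (\<Sum>t\<in>{1..T}. \<Sum>i<n. x t i * cnj (e i)) \<le> cmod (\<Sum>i<n. \<Sum>j\<in>{mI..<m}. Z i j * \<delta> j * cnj (e i))"
      by (simp only: complex_Re_le_cmod)
    also have "\<dots> \<le> (\<Sum>i<n. \<Sum>j\<in>{mI..<m}. cmod (Z i j) * (N * E))"
    proof (intro order.trans[OF norm_sum] sum_mono)
      fix i j assume "i \<in> {..<n}" "j \<in> {mI..<m}"
      then have "cmod (\<delta> j) * cmod (e i) \<le> N * E" using N E by (intro mult_mono) auto
      then show "cmod (Z i j * \<delta> j * cnj (e i)) \<le> cmod (Z i j) * (N * E)"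
        by (simp add: norm_mult mult.assoc mult_left_mono)
    qed
    also have "\<dots> = S * (N * E)"
      by (simp add: S_def sum_distrib_right)
    finally have cross: "Re (\<Sum>t\<in>{1..T}. \<Sum>i<n. x t i * cnj (e i)) \<le> S * (N * E)" .
    have "N\<^sup>2 \<le> C0\<^sup>2 * real n * (\<Sum>i<n. (cmod (x t i))\<^sup>2)" if "t \<in> {1..T}" for t
    proof -
      have "N \<le> C0 * (\<Sum>i<n. cmod (x t i))"
        unfolding N_def x_def by (rule C0(2)[OF Q[OF that]])
      then have "N\<^sup>2 \<le> (C0 * (\<Sum>i<n. cmod (x t i)))\<^sup>2" using N by (intro power_mono)
      also have "\<dots> \<le> C0\<^sup>2 * (real n * (\<Sum>i<n. (cmod (x t i))\<^sup>2))"
        unfolding power_mult_distrib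
        using sum_squared_le_sum_of_squares[of "\<lambda>i. cmod (x t i)" "{..<n}"]
        by (intro mult_left_mono) (auto simp: mult.commute)
      finally show ?thesis by (simp add: mult.assoc)
    qed
    then have "(\<Sum>t\<in>{1..T}. N\<^sup>2) \<le> (\<Sum>t\<in>{1..T}. C0\<^sup>2 * real n * (\<Sum>i<n. (cmod (x t i))\<^sup>2))"
      by (rule sum_mono)
    then have "real T * N\<^sup>2 \<le> C0\<^sup>2 * real n * (\<Sum>t\<in>{1..T}. \<Sum>i<n. (cmod (x t i))\<^sup>2)"
      by (simp add: sum_distrib_left)
    also have "\<dots> \<le> C0\<^sup>2 * real n * (2 * (S * (N * E)))"
      using quad cross by (intro mult_left_mono) auto
    \<comment> \<open>Quadratic in \<open>N\<close> against linear: one factor cancels unless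
      \<open>N = 0\<close>.\<close>
    finally have "N * (real T * N) \<le> N * (C * S)"
      by (simp add: C_def power2_eq_square mult_ac)
    then have "real T * N \<le> C * S \<or> N = 0"
      using N(1) by (auto simp: mult_le_cancel_left)
    then have "N \<le> C * (S / real T)"
      using T S \<open>C \<ge> 0\<close> by (auto simp: field_simps)
    moreover have "(\<Sum>j\<in>{mI..<m}. cmod (b j)) \<le> N"
    proof -
      \<comment> \<open>The competitor \<open>b1\<close> vanishes at these indices, so
        \<open>b\<close> and \<open>\<delta>\<close> agree there.\<close>
      have "(\<Sum>j\<in>{mI..<m}. cmod (b j)) = (\<Sum>j\<in>{mI..<m}. cmod (\<delta> j))"
        by (intro sum.cong) (auto simp: \<delta>_def b1_def)
      also have "\<dots> \<le> N" unfolding N_def by (intro sum_mono2) auto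
      finally show ?thesis .
    qed
    ultimately show "(\<Sum>j\<in>{mI..<m}. cmod (b j))
        \<le> C * ((\<Sum>i<n. \<Sum>j\<in>{mI..<m}. cmod (\<Sum>t\<in>{1..T}. sphere_cut (\<phi> j) (rot (Q t) (R i)))) / real T)"
      by (simp add: S_def Z_def)
  qed
qed

end

section \<open>From the deterministic bound to the almost sure rate\<close>

lemma (in invariant_basis) haar_sums_rate:
  fixes Qr :: "nat \<Rightarrow> 'w \<Rightarrow> real^'n^'n"
  assumes M: "prob_space M"
    and rv: "\<And>t. t \<ge> 1 \<Longrightarrow> Qr t \<in> measurable M borel"
    and dist: "\<And>t. t \<ge> 1 \<Longrightarrow> distr M borel (Qr t) = H"
    and indep: "prob_space.indep_vars M (\<lambda>_. borel) Qr {1..}"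
    and j: "mI \<le> j" "j < m" and r: "r \<in> sphereN" and \<epsilon>: "\<epsilon> > 0"
  shows "AE \<omega> in M. (\<lambda>T. cmod (\<Sum>t\<in>{1..T}. sphere_cut (\<phi> j) (rot (Qr t \<omega>) r))
            / (sqrt (real T) * ln (real T) powr (1/2 + \<epsilon>))) \<longlonglongrightarrow> 0"
proof -
  interpret M: prob_space M by fact
  define Z where "Z Q = sphere_cut (\<phi> j) (rot Q r)" for Q
  have Z [measurable]: "Z \<in> borel_measurable borel"
    unfolding Z_def by (rule borel_measurable_cut_rot[OF phi_V[OF j(2)]])
  have Z_int: "integrable H Z" and Z_0: "(\<integral>Q. Z Q \<partial>H) = 0"
    unfolding Z_def using integrable_cut_rot(1)[OF phi_V[OF j(2)]] integral_phi_rot_zero[OF j r] by auto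
  obtain C where C: "\<And>r. cmod (sphere_cut (\<phi> j) r) \<le> C"
    using sphere_cut_Vspace_bounded[OF phi_V[OF j(2)]] by blast
  \<comment> \<open>The scalar estimate is for real variables; \<open>p\<close> will be
    \<open>Re\<close> and \<open>Im\<close>, both of which inherit the bound and the zero
    mean.\<close>
  have rate: "AE \<omega> in M. (\<lambda>T. \<bar>\<Sum>t\<in>{1..T}. p (Z (Qr t \<omega>))\<bar>
      / (sqrt (real T) * ln (real T) powr (1/2 + \<epsilon>))) \<longlonglongrightarrow> 0"
    if p [measurable]: "p \<in> borel_measurable borel"
      and p_le: "\<And>z. \<bar>p z\<bar> \<le> cmod z" and p_0: "(\<integral>Q. p (Z Q) \<partial>H) = 0" for p :: "complex \<Rightarrow> real"
  proof (rule M.bounded_centred_sums_rate[OF _ _ _ \<epsilon>])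
    show "M.indep_vars (\<lambda>_. borel) (\<lambda>t \<omega>. p (Z (Qr t \<omega>))) {1..}"
      by (rule M.indep_vars_compose2[OF indep]) measurable
    show "AE \<omega> in M. \<bar>p (Z (Qr t \<omega>))\<bar> \<le> C" for t
      using order.trans[OF p_le C] by (simp add: Z_def)
    show "M.expectation (\<lambda>\<omega>. p (Z (Qr t \<omega>))) = 0" if "t \<ge> 1" for t
      using p_0 dist[OF that] integral_distr[OF rv[OF that], of "\<lambda>Q. p (Z Q)"] by simp
  qed
  have "AE \<omega> in M. (\<lambda>T. \<bar>\<Sum>t\<in>{1..T}. Re (Z (Qr t \<omega>))\<bar>
      / (sqrt (real T) * ln (real T) powr (1/2 + \<epsilon>))) \<longlonglongrightarrow> 0"
    using Z_int Z_0 by (intro rate) (auto simp: abs_Re_le_cmod)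
  moreover have "AE \<omega> in M. (\<lambda>T. \<bar>\<Sum>t\<in>{1..T}. Im (Z (Qr t \<omega>))\<bar>
      / (sqrt (real T) * ln (real T) powr (1/2 + \<epsilon>))) \<longlonglongrightarrow> 0"
    using Z_int Z_0 by (intro rate) (auto simp: abs_Im_le_cmod)
  ultimately show ?thesis
  proof eventually_elim
    case (elim \<omega>)
    show ?case
    proof (rule Lim_null_comparison[OF always_eventually tendsto_add_zero[OF elim]], rule allI)
      fix T
      show "norm (cmod (\<Sum>t\<in>{1..T}. sphere_cut (\<phi> j) (rot (Qr t \<omega>) r)) / (sqrt (real T) * ln (real T) powr (1/2 + \<epsilon>)))
        \<le> \<bar>\<Sum>t\<in>{1..T}. Re (Z (Qr t \<omega>))\<bar> / (sqrt (real T) * ln (real T) powr (1/2 + \<epsilon>))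
          + \<bar>\<Sum>t\<in>{1..T}. Im (Z (Qr t \<omega>))\<bar> / (sqrt (real T) * ln (real T) powr (1/2 + \<epsilon>))"
        using cmod_le[of "\<Sum>t\<in>{1..T}. Z (Qr t \<omega>)"]
        by (simp add: Z_def add_divide_distrib[symmetric] divide_right_mono)
    qed
  qed
qed

theorem mainTheorem9:
  fixes K n m mI :: nat
    and \<phi> :: "nat \<Rightarrow> ('m::finite \<Rightarrow> real^'n::finite) \<Rightarrow> complex"
    and R :: "nat \<Rightarrow> 'm \<Rightarrow> real^'n"
    and f :: "('m \<Rightarrow> real^'n) \<Rightarrow> complex"
    and M :: "'w measure"
    and H :: "(real^'n^'n) measure"
    and Qr :: "nat \<Rightarrow> 'w \<Rightarrow> real^'n^'n"
    and \<beta> :: "nat \<Rightarrow> 'w \<Rightarrow> nat \<Rightarrow> complex"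
  assumes phi_V: "\<And>j. j < m \<Longrightarrow> \<phi> j \<in> Vspace K"
    and phi_orthonormal: "\<And>j k. j < m \<Longrightarrow> k < m \<Longrightarrow> L2inner (\<phi> j) (\<phi> k) = (if j = k then 1 else 0)"
    and phi_span: "\<And>g. g \<in> Vspace K \<Longrightarrow> \<exists>c. \<forall>r\<in>sphereN. g r = (\<Sum>j<m. c j * \<phi> j r)"
    and mI_le: "mI \<le> m"
    and phi_B: "\<And>j. j < mI \<Longrightarrow> \<phi> j \<in> Bspace K"
    and phi_B_span: "\<And>g. g \<in> Bspace K \<Longrightarrow> \<exists>c. \<forall>r\<in>sphereN. g r = (\<Sum>j<mI. c j * \<phi> j r)"
    and phi_Bperp: "\<And>j g. mI \<le> j \<Longrightarrow> j < m \<Longrightarrow> g \<in> Bspace K \<Longrightarrow> L2inner (\<phi> j) g = 0"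
    and R_sphere: "\<And>i. i < n \<Longrightarrow> R i \<in> sphereN"
    and f_inv: "rot_invariant f"
    and A_rank: "full_column_rank n m (\<lambda>i j. \<phi> j (R i))"
    and M_prob: "prob_space M"
    and H_haar: "is_haar_SO H"
    and Q_rv: "\<And>t. t \<ge> 1 \<Longrightarrow> Qr t \<in> measurable M borel"
    and Q_dist: "\<And>t. t \<ge> 1 \<Longrightarrow> distr M borel (Qr t) = H"
    and Q_indep: "prob_space.indep_vars M (\<lambda>_. borel) Qr {1..}"
    and beta_min: "\<And>T \<omega> b. \<omega> \<in> space M \<Longrightarrow>
        L_aug n m \<phi> R (\<lambda>i. f (R i)) T (\<lambda>_. 1 / real T) (\<lambda>t. Qr t \<omega>) (\<beta> T \<omega>)
        \<le> L_aug n m \<phi> R (\<lambda>i. f (R i)) T (\<lambda>_. 1 / real T) (\<lambda>t. Qr t \<omega>) b"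
  shows "\<And>\<epsilon>::real. \<epsilon> > 0 \<Longrightarrow>
    AE \<omega> in M. (\<lambda>T. eps_sym (\<lambda>r. \<Sum>j<m. \<beta> T \<omega> j * \<phi> j r) * sqrt (real T)
                     / (ln (real T)) powr (1/2 + \<epsilon>)) \<longlonglongrightarrow> 0"
proof -
  fix \<epsilon> :: real assume \<epsilon>: "\<epsilon> > 0"
  interpret invariant_basis K m mI n \<phi> R H
    by unfold_locales (fact phi_V phi_span mI_le phi_B phi_Bperp R_sphere A_rank H_haar)+
  interpret M: prob_space M by fact
  obtain C1 where C1: "C1 \<ge> 0"
    "\<And>\<beta>. eps_sym (\<lambda>r. \<Sum>j<m. \<beta> j * \<phi> j r) \<le> C1 * (\<Sum>j\<in>{mI..<m}. cmod (\<beta> j))"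
    using eps_sym_le_coefficients by blast
  obtain C2 where C2: "C2 \<ge> 0"
    "\<And>T Q b. T \<ge> 1 \<Longrightarrow> (\<And>t. t \<in> {1..T} \<Longrightarrow> Q t \<in> SOgrp) \<Longrightarrow>
      (\<And>b'. L_aug n m \<phi> R (\<lambda>i. f (R i)) T (\<lambda>_. 1 / real T) Q b
        \<le> L_aug n m \<phi> R (\<lambda>i. f (R i)) T (\<lambda>_. 1 / real T) Q b') \<Longrightarrow>
      (\<Sum>j\<in>{mI..<m}. cmod (b j))
        \<le> C2 * ((\<Sum>i<n. \<Sum>j\<in>{mI..<m}. cmod (\<Sum>t\<in>{1..T}. sphere_cut (\<phi> j) (rot (Q t) (R i)))) / real T)"
    by (rule minimiser_noninvariant_part_le[of "\<lambda>i. f (R i)"]) (rule that; blast)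
  define a where "a T = sqrt (real T) * ln (real T) powr (1/2 + \<epsilon>)" for T :: nat
  have "AE \<omega> in M. Qr t \<omega> \<in> SOgrp" if "t \<ge> 1" for t
    using AE_H by (intro AE_distrD[OF Q_rv[OF that]]) (simp only: Q_dist[OF that])
  then have "AE \<omega> in M. \<forall>t\<in>{1..}. Qr t \<omega> \<in> SOgrp"
    by (intro AE_ball_countable') auto
  moreover have "AE \<omega> in M. \<forall>i\<in>{..<n}. \<forall>j\<in>{mI..<m}.
      (\<lambda>T. cmod (\<Sum>t\<in>{1..T}. sphere_cut (\<phi> j) (rot (Qr t \<omega>) (R i))) / a T) \<longlonglongrightarrow> 0"
    unfolding a_def
    by (intro AE_finite_allI haar_sums_rate M_prob Q_rv Q_dist Q_indep R_sphere \<epsilon>) auto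
  ultimately show "AE \<omega> in M. (\<lambda>T. eps_sym (\<lambda>r. \<Sum>j<m. \<beta> T \<omega> j * \<phi> j r) * sqrt (real T)
      / (ln (real T)) powr (1/2 + \<epsilon>)) \<longlonglongrightarrow> 0"
    using AE_space
  proof eventually_elim
    case (elim \<omega>)
    define Z where "Z T = (\<Sum>i<n. \<Sum>j\<in>{mI..<m}. cmod (\<Sum>t\<in>{1..T}. sphere_cut (\<phi> j) (rot (Qr t \<omega>) (R i))))" for T
    have "(\<lambda>T. \<Sum>i<n. \<Sum>j\<in>{mI..<m}. cmod (\<Sum>t\<in>{1..T}. sphere_cut (\<phi> j) (rot (Qr t \<omega>) (R i))) / a T) \<longlonglongrightarrow> 0"
      using elim(2) by (intro tendsto_null_sum) auto
    then have "(\<lambda>T. Z T / a T) \<longlonglongrightarrow> 0"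
      by (simp add: Z_def sum_divide_distrib)
    from tendsto_mult_right_zero[OF this, of "C1 * C2"]
    have lim: "(\<lambda>T. C1 * C2 * (Z T / a T)) \<longlonglongrightarrow> 0" .
    show ?case
    proof (rule Lim_null_comparison[OF _ lim])
      show "\<forall>\<^sub>F T in sequentially. norm (eps_sym (\<lambda>r. \<Sum>j<m. \<beta> T \<omega> j * \<phi> j r) * sqrt (real T)
          / (ln (real T)) powr (1/2 + \<epsilon>)) \<le> C1 * C2 * (Z T / a T)"
        using eventually_ge_at_top[of 1]
      proof eventually_elim
        case (elim T)
        define s where "s = eps_sym (\<lambda>r. \<Sum>j<m. \<beta> T \<omega> j * \<phi> j r)"
        have "s \<ge> 0" by (simp add: s_def eps_sym_def L2norm_def)
        have "s \<le> C1 * (\<Sum>j\<in>{mI..<m}. cmod (\<beta> T \<omega> j))"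
          unfolding s_def by (rule C1(2))
        also have "\<dots> \<le> C1 * (C2 * (Z T / real T))"
          unfolding Z_def using \<open>\<forall>t\<in>{1..}. Qr t \<omega> \<in> SOgrp\<close>
          by (intro mult_left_mono C1(1) C2(2) elim beta_min \<open>\<omega> \<in> space M\<close>) auto
        finally have "s * sqrt (real T) \<le> C1 * (C2 * (Z T / real T)) * sqrt (real T)"
          by (intro mult_right_mono) auto
        \<comment> \<open>The factor \<open>sqrt T\<close> in the claim turns the sample mean
          \<open>Z T / T\<close> into the sum divided by \<open>sqrt T\<close>, the normalisation of
          the scalar rate.\<close>
        also have "\<dots> = C1 * C2 * (Z T / sqrt (real T))"
          using elim by (simp add: field_simps real_sqrt_mult_self)
        finally have "s * sqrt (real T) / ln (real T) powr (1/2 + \<epsilon>)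
            \<le> C1 * C2 * (Z T / sqrt (real T)) / ln (real T) powr (1/2 + \<epsilon>)"
          by (intro divide_right_mono) auto
        then show ?case
          using \<open>s \<ge> 0\<close> by (simp add: s_def[symmetric] a_def)
      qed
    qed
  qed
qed

end
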